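(* (1) $\mathsf{Par}(\mathcal C,\mathcal S)\cong\mathsf{Sect}(\mathcal C,\mathcal S)/\!\sim$, with the congruence $\sim$ induced by the functor $\Gamma:\mathsf{Sect}(\mathcal C,\mathcal S)\to\mathsf{Par}(\mathcal C,\mathcal S)$, $[s,f]_{\mathrm a}\mapsto[s,f]_{\mathrm z^\star}$. (2) If $\mathcal S$ is a class of monomorphisms, then $\mathsf{Par}(\mathcal C,\mathcal S)\cong\mathsf{Sect}(\mathcal C,\mathcal S)\cong\mathsf{Span}(\mathcal C,\mathcal S)$.
   Context: Standing assumptions: $\mathcal C$ is a category and $\mathcal S$ is a class of morphisms of $\mathcal C$ that contains all isomorphisms, is closed under composition, and is such that pullbacks of $\mathcal S$-morphisms along arbitrary morphisms exist in $\mathcal C$ and belong to $\mathcal S$. $\mathcal S$-spans: an $\mathcal S$-span $(s,f):A\to B$ is a pair $s:D\to A$ in $\mathcal S$, $f:D\to B$ in $\mathcal C$. A (vertical) morphism $x:(s,f)\to(\tilde s,\tilde f)$ is a $\mathcal C$-morphism with $\tilde s\cdot x=s$, $\tilde f\cdot x=f$. Isomorphic $\mathcal S$-spans are identified. $\mathsf{Span}(\mathcal C,\mathcal S)$ is the category with the objects of $\mathcal C$ and (isomorphism classes of) $\mathcal S$-spans as morphisms, with (horizontal) composition $(t,g)\cdot(s,f)=(s\cdot t',g\cdot f')$, where $f\cdot t'=t\cdot f'$ is a pullback square. A relation for $\mathcal S$-spans is compatible if it relates only $\mathcal S$-spans with the same domain and codomain, relates vertically isomorphic $\mathcal S$-spans,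 and is preserved by horizontal composition from either side. $\mathcal S$-cospans: an $\mathcal S$-cospan $\langle f,s\rangle:A\to B$ is (the isomorphism class of) a pair $f:A\to D$ in $\mathcal C$, $s:B\to D$ in $\mathcal S$. A morphism $v:\langle f,s\rangle\to\langle g,t\rangle$ is a $\mathcal C$-morphism with $v\cdot f=g$, $v\cdot s=t$; write $\langle f,s\rangle\preceq\langle g,t\rangle$ if there is such $v$ in $\mathcal S$. $\mathrm{pb}\langle f,s\rangle:=(s',f')$ is the $\mathcal S$-span given by the pullback square $f\cdot s'=s\cdot f'$. The conjugate of $v:\langle f,s\rangle\to\langle g,t\rangle$ is the unique $v^\star$ with $t'\cdot v^\star=s'$, $g'\cdot v^\star=f'$, where $(s',f')=\mathrm{pb}\langle f,s\rangle$, $(t',g')=\mathrm{pb}\langle g,t\rangle$. $\mathcal S^\star$ is the class of all existing pullbacks in $\mathcal C$ of conjugates $v^\star$ of $\mathcal S$-cospan morphisms $v$ with $v\in\mathcal S$. $\mathsf{Sect}(\mathcal C,\mathcal S)$ is the quotient of $\mathsf{Span}(\mathcal C,\mathcal S)$ by $\sim_{\mathrm a}$, the equivalence relation generated by the least compatible relation $\approx_{\mathrm a}$ such that $\langle f,s\rangle\preceq\langle g,t\rangle$ implies $\mathrm{pb}\langle f,s\rangle\approx_{\mathrm a}\mathrm{pb}\langle g,t\rangle$; classes are written $[s,f]_{\mathrm a}$. $\mathsf{Par}(\mathcal C,\mathcal S)$ is the quotient of $\mathsf{Span}(\mathcal C,\mathcal S)$ by $\sim_{\mathrm z^\star}$,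 the least equivalence relation relating $(s,f)$ and $(\tilde s,\tilde f)$ whenever there is a morphism $x:(s,f)\to(\tilde s,\tilde f)$ with $x\in\mathcal S^\star$; classes are written $[s,f]_{\mathrm z^\star}$. Both relations are compatible, and $\sim_{\mathrm a}\subseteq\sim_{\mathrm z^\star}$, so $\Gamma$ is well defined. The congruence induced by $\Gamma$ relates parallel morphisms having the same image under $\Gamma$. *)

theory Defs
  imports Main
begin

section \<open>Categories, functors and quotient categories\<close>

text \<open>Objects and arrows are carrier sets, so proper classes cause no size problem.
  \<^term>\<open>Comp\<close> is unspecified on non-composable pairs; the order is \<open>g\<close> after \<open>f\<close>.\<close>

record ('o, 'a) cat =
  Obj :: "'o set"
  Arr :: "'a set"
  Dom :: "'a \<Rightarrow> 'o"
  Cod :: "'a \<Rightarrow> 'o"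
  Ident :: "'o \<Rightarrow> 'a"
  Comp :: "'a \<Rightarrow> 'a \<Rightarrow> 'a" (infixl "\<cdot>\<index>" 70)

definition Hom :: "('o, 'a) cat \<Rightarrow> 'o \<Rightarrow> 'o \<Rightarrow> 'a set" where
  "Hom C A B = {f \<in> Arr C. Dom C f = A \<and> Cod C f = B}"

locale category =
  fixes C :: "('o, 'a) cat" (structure)
  assumes dom_obj: "f \<in> Arr C \<Longrightarrow> Dom C f \<in> Obj C"
    and cod_obj: "f \<in> Arr C \<Longrightarrow> Cod C f \<in> Obj C"
    and ident_hom: "A \<in> Obj C \<Longrightarrow> Ident C A \<in> Hom C A A"
    and comp_hom: "\<lbrakk>f \<in> Arr C; g \<in> Arr C; Cod C f = Dom C g\<rbrakk>
      \<Longrightarrow> g \<cdot> f \<in> Hom C (Dom C f) (Cod C g)"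
    and ident_right: "f \<in> Arr C \<Longrightarrow> f \<cdot> Ident C (Dom C f) = f"
    and ident_left: "f \<in> Arr C \<Longrightarrow> Ident C (Cod C f) \<cdot> f = f"
    and comp_assoc: "\<lbrakk>f \<in> Arr C; g \<in> Arr C; h \<in> Arr C; Cod C f = Dom C g; Cod C g = Dom C h\<rbrakk>
      \<Longrightarrow> (h \<cdot> g) \<cdot> f = h \<cdot> (g \<cdot> f)"

definition is_iso :: "('o, 'a) cat \<Rightarrow> 'a \<Rightarrow> bool" where
  "is_iso C f \<longleftrightarrow> f \<in> Arr C \<and> (\<exists>g \<in> Hom C (Cod C f) (Dom C f).
     g \<cdot>\<^bsub>C\<^esub> f = Ident C (Dom C f) \<and> f \<cdot>\<^bsub>C\<^esub> g = Ident C (Cod C f))"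

definition is_mono :: "('o, 'a) cat \<Rightarrow> 'a \<Rightarrow> bool" where
  "is_mono C f \<longleftrightarrow> f \<in> Arr C \<and> (\<forall>A. \<forall>a \<in> Hom C A (Dom C f). \<forall>b \<in> Hom C A (Dom C f).
     f \<cdot>\<^bsub>C\<^esub> a = f \<cdot>\<^bsub>C\<^esub> b \<longrightarrow> a = b)"

text \<open>\<open>is_pullback C f g p q\<close>: the square \<open>f \<cdot> p = g \<cdot> q\<close> is a pullback, so that \<open>p\<close> is a
  pullback of \<open>g\<close> along \<open>f\<close>, and \<open>q\<close> one of \<open>f\<close> along \<open>g\<close>.\<close>

definition is_pullback :: "('o, 'a) cat \<Rightarrow> 'a \<Rightarrow> 'a \<Rightarrow> 'a \<Rightarrow> 'a \<Rightarrow> bool" where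
  "is_pullback C f g p q \<longleftrightarrow>
     f \<in> Arr C \<and> g \<in> Arr C \<and> p \<in> Arr C \<and> q \<in> Arr C \<and>
     Cod C f = Cod C g \<and> Cod C p = Dom C f \<and> Cod C q = Dom C g \<and> Dom C p = Dom C q \<and>
     f \<cdot>\<^bsub>C\<^esub> p = g \<cdot>\<^bsub>C\<^esub> q \<and>
     (\<forall>A. \<forall>a \<in> Hom C A (Dom C f). \<forall>b \<in> Hom C A (Dom C g). f \<cdot>\<^bsub>C\<^esub> a = g \<cdot>\<^bsub>C\<^esub> b \<longrightarrow>
        (\<exists>!u. u \<in> Hom C A (Dom C p) \<and> p \<cdot>\<^bsub>C\<^esub> u = a \<and> q \<cdot>\<^bsub>C\<^esub> u = b))"

text \<open>A functor is given by its object map \<open>Fo\<close> and its arrow map \<open>Fa\<close>.\<close>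

definition is_functor ::
    "('o, 'a) cat \<Rightarrow> ('p, 'b) cat \<Rightarrow> ('o \<Rightarrow> 'p) \<Rightarrow> ('a \<Rightarrow> 'b) \<Rightarrow> bool" where
  "is_functor C D Fo Fa \<longleftrightarrow> category C \<and> category D \<and>
     (\<forall>A \<in> Obj C. Fo A \<in> Obj D) \<and>
     (\<forall>f \<in> Arr C. Fa f \<in> Hom D (Fo (Dom C f)) (Fo (Cod C f))) \<and>
     (\<forall>A \<in> Obj C. Fa (Ident C A) = Ident D (Fo A)) \<and>
     (\<forall>f \<in> Arr C. \<forall>g \<in> Arr C. Cod C f = Dom C g \<longrightarrow>
        Fa (g \<cdot>\<^bsub>C\<^esub> f) = Fa g \<cdot>\<^bsub>D\<^esub> Fa f)"

definition isomorphic_categories :: "('o, 'a) cat \<Rightarrow> ('p, 'b) cat \<Rightarrow> bool" where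
  "isomorphic_categories C D \<longleftrightarrow> (\<exists>Fo Fa Go Ga.
     is_functor C D Fo Fa \<and> is_functor D C Go Ga \<and>
     (\<forall>A \<in> Obj C. Go (Fo A) = A) \<and> (\<forall>f \<in> Arr C. Ga (Fa f) = f) \<and>
     (\<forall>B \<in> Obj D. Fo (Go B) = B) \<and> (\<forall>g \<in> Arr D. Fa (Ga g) = g))"

definition induced_congruence :: "('o, 'a) cat \<Rightarrow> ('a \<Rightarrow> 'b) \<Rightarrow> ('a \<times> 'a) set" where
  "induced_congruence C Fa = {(f, g). f \<in> Arr C \<and> g \<in> Arr C \<and>
     Dom C f = Dom C g \<and> Cod C f = Cod C g \<and> Fa f = Fa g}"

text \<open>Meaningful when \<open>R\<close> is a congruence: an equivalence relation on the arrows that relates only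
  parallel arrows and is preserved by composition.\<close>

definition quotient_category :: "('o, 'a) cat \<Rightarrow> ('a \<times> 'a) set \<Rightarrow> ('o, 'a set) cat" where
  "quotient_category C R =
     \<lparr>Obj = Obj C,
      Arr = Arr C // R,
      Dom = (\<lambda>X. the_elem (Dom C ` X)),
      Cod = (\<lambda>X. the_elem (Cod C ` X)),
      Ident = (\<lambda>A. R `` {Ident C A}),
      Comp = (\<lambda>Y X. \<Union>g \<in> Y. \<Union>f \<in> X. R `` {g \<cdot>\<^bsub>C\<^esub> f})\<rparr>"

definition generated_equiv :: "'b set \<Rightarrow> ('b \<times> 'b) set \<Rightarrow> ('b \<times> 'b) set" where
  "generated_equiv A R = \<Inter>{E. equiv A E \<and> R \<subseteq> E}"


section \<open>Spans\<close>

locale span_setting = category C for C :: "('o, 'a) cat" (structure) +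
  fixes S :: "'a set"
  assumes S_arr: "S \<subseteq> Arr C"
    and S_iso: "is_iso C f \<Longrightarrow> f \<in> S"
    and S_comp: "\<lbrakk>s \<in> S; t \<in> S; Cod C s = Dom C t\<rbrakk> \<Longrightarrow> t \<cdot> s \<in> S"
    and S_pullback_exists: "\<lbrakk>s \<in> S; f \<in> Arr C; Cod C f = Cod C s\<rbrakk>
      \<Longrightarrow> \<exists>s' f'. is_pullback C f s s' f'"
    and S_pullback: "\<lbrakk>s \<in> S; is_pullback C f s s' f'\<rbrakk> \<Longrightarrow> s' \<in> S"

text \<open>A span \<open>(s, f)\<close> goes from \<open>Cod C s\<close> to \<open>Cod C f\<close>. Here spans are not yet identified up to
  isomorphism, and \<open>is_span_comp C q p r\<close> says that \<open>r\<close> is a composite \<open>q \<cdot> p\<close> for some choice of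
  the pullback.\<close>

definition spans :: "('o, 'a) cat \<Rightarrow> 'a set \<Rightarrow> ('a \<times> 'a) set" where
  "spans C S = {(s, f). s \<in> S \<and> f \<in> Arr C \<and> Dom C s = Dom C f}"

definition is_span_mor :: "('o, 'a) cat \<Rightarrow> 'a \<Rightarrow> 'a \<times> 'a \<Rightarrow> 'a \<times> 'a \<Rightarrow> bool" where
  "is_span_mor C x p q \<longleftrightarrow> x \<in> Hom C (Dom C (fst p)) (Dom C (fst q)) \<and>
     fst q \<cdot>\<^bsub>C\<^esub> x = fst p \<and> snd q \<cdot>\<^bsub>C\<^esub> x = snd p"

definition span_iso :: "('o, 'a) cat \<Rightarrow> 'a set \<Rightarrow> (('a \<times> 'a) \<times> ('a \<times> 'a)) set" where
  "span_iso C S = {(p, q). p \<in> spans C S \<and> q \<in> spans C S \<and>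
     (\<exists>x. is_iso C x \<and> is_span_mor C x p q)}"

definition is_span_comp :: "('o, 'a) cat \<Rightarrow> 'a \<times> 'a \<Rightarrow> 'a \<times> 'a \<Rightarrow> 'a \<times> 'a \<Rightarrow> bool" where
  "is_span_comp C q p r \<longleftrightarrow> (\<exists>t' f'. is_pullback C (snd p) (fst q) t' f' \<and>
     r = (fst p \<cdot>\<^bsub>C\<^esub> t', snd q \<cdot>\<^bsub>C\<^esub> f'))"

definition span_cat :: "('o, 'a) cat \<Rightarrow> 'a set \<Rightarrow> ('o, ('a \<times> 'a) set) cat" where
  "span_cat C S =
     \<lparr>Obj = Obj C,
      Arr = spans C S // span_iso C S,
      Dom = (\<lambda>X. the_elem ((\<lambda>p. Cod C (fst p)) ` X)),
      Cod = (\<lambda>X. the_elem ((\<lambda>p. Cod C (snd p)) ` X)),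
      Ident = (\<lambda>A. span_iso C S `` {(Ident C A, Ident C A)}),
      Comp = (\<lambda>Y X. \<Union>q \<in> Y. \<Union>p \<in> X. span_iso C S `` {r. is_span_comp C q p r})\<rparr>"

definition compatible ::
    "('o, 'a) cat \<Rightarrow> 'a set \<Rightarrow> (('a \<times> 'a) \<times> ('a \<times> 'a)) set \<Rightarrow> bool" where
  "compatible C S R \<longleftrightarrow>
     (\<forall>(p, q) \<in> R. p \<in> spans C S \<and> q \<in> spans C S \<and>
        Cod C (fst p) = Cod C (fst q) \<and> Cod C (snd p) = Cod C (snd q)) \<and>
     span_iso C S \<subseteq> R \<and>
     (\<forall>(p, q) \<in> R. \<forall>r \<in> spans C S. \<forall>p' q'.
        is_span_comp C r p p' \<and> is_span_comp C r q q' \<longrightarrow> (p', q') \<in> R) \<and>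
     (\<forall>(p, q) \<in> R. \<forall>r \<in> spans C S. \<forall>p' q'.
        is_span_comp C p r p' \<and> is_span_comp C q r q' \<longrightarrow> (p', q') \<in> R)"

text \<open>A relation on spans, transported to the isomorphism classes that are the arrows of
  \<^const>\<open>span_cat\<close>.\<close>

definition on_classes ::
    "('o, 'a) cat \<Rightarrow> 'a set \<Rightarrow> (('a \<times> 'a) \<times> ('a \<times> 'a)) set
      \<Rightarrow> (('a \<times> 'a) set \<times> ('a \<times> 'a) set) set" where
  "on_classes C S R = {(span_iso C S `` {p}, span_iso C S `` {q}) | p q. (p, q) \<in> R}"


section \<open>Cospans and conjugates\<close>

definition cospans :: "('o, 'a) cat \<Rightarrow> 'a set \<Rightarrow> ('a \<times> 'a) set" where
  "cospans C S = {(f, s). f \<in> Arr C \<and> s \<in> S \<and> Cod C f = Cod C s}"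

definition is_cospan_mor :: "('o, 'a) cat \<Rightarrow> 'a \<Rightarrow> 'a \<times> 'a \<Rightarrow> 'a \<times> 'a \<Rightarrow> bool" where
  "is_cospan_mor C v c d \<longleftrightarrow> v \<in> Hom C (Cod C (fst c)) (Cod C (fst d)) \<and>
     v \<cdot>\<^bsub>C\<^esub> fst c = fst d \<and> v \<cdot>\<^bsub>C\<^esub> snd c = snd d"

definition cospan_le :: "('o, 'a) cat \<Rightarrow> 'a set \<Rightarrow> 'a \<times> 'a \<Rightarrow> 'a \<times> 'a \<Rightarrow> bool" where
  "cospan_le C S c d \<longleftrightarrow> (\<exists>v \<in> S. is_cospan_mor C v c d)"

text \<open>\<open>is_pb C c p\<close>: the span \<open>p = (s', f')\<close> is a pullback of the cospan \<open>c = (f, s)\<close>.\<close>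

definition is_pb :: "('o, 'a) cat \<Rightarrow> 'a \<times> 'a \<Rightarrow> 'a \<times> 'a \<Rightarrow> bool" where
  "is_pb C c p \<longleftrightarrow> is_pullback C (fst c) (snd c) (fst p) (snd p)"

text \<open>\<open>w\<close> is the conjugate of \<open>v\<close>, for some choice of the two pullbacks; it is determined up to
  isomorphisms on either side.\<close>

definition is_conjugate ::
    "('o, 'a) cat \<Rightarrow> 'a \<times> 'a \<Rightarrow> 'a \<times> 'a \<Rightarrow> 'a \<Rightarrow> 'a \<Rightarrow> bool" where
  "is_conjugate C c d v w \<longleftrightarrow> is_cospan_mor C v c d \<and>
     (\<exists>p q. is_pb C c p \<and> is_pb C d q \<and> is_span_mor C w p q)"

definition S_star :: "('o, 'a) cat \<Rightarrow> 'a set \<Rightarrow> 'a set" where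
  "S_star C S = {x. \<exists>c \<in> cospans C S. \<exists>d \<in> cospans C S. \<exists>v \<in> S. \<exists>w k h.
     is_conjugate C c d v w \<and> is_pullback C k w x h}"


section \<open>The categories Sect and Par and the functor between them\<close>

definition approx_a :: "('o, 'a) cat \<Rightarrow> 'a set \<Rightarrow> (('a \<times> 'a) \<times> ('a \<times> 'a)) set" where
  "approx_a C S = \<Inter>{R. compatible C S R \<and>
     (\<forall>c \<in> cospans C S. \<forall>d \<in> cospans C S. \<forall>p q.
        cospan_le C S c d \<and> is_pb C c p \<and> is_pb C d q \<longrightarrow> (p, q) \<in> R)}"

definition sim_a :: "('o, 'a) cat \<Rightarrow> 'a set \<Rightarrow> (('a \<times> 'a) \<times> ('a \<times> 'a)) set" where
  "sim_a C S = generated_equiv (spans C S) (approx_a C S)"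

definition sim_zstar :: "('o, 'a) cat \<Rightarrow> 'a set \<Rightarrow> (('a \<times> 'a) \<times> ('a \<times> 'a)) set" where
  "sim_zstar C S = generated_equiv (spans C S)
     {(p, q). p \<in> spans C S \<and> q \<in> spans C S \<and> (\<exists>x \<in> S_star C S. is_span_mor C x p q)}"

definition sect_cat :: "('o, 'a) cat \<Rightarrow> 'a set \<Rightarrow> ('o, ('a \<times> 'a) set set) cat" where
  "sect_cat C S = quotient_category (span_cat C S) (on_classes C S (sim_a C S))"

definition par_cat :: "('o, 'a) cat \<Rightarrow> 'a set \<Rightarrow> ('o, ('a \<times> 'a) set set) cat" where
  "par_cat C S = quotient_category (span_cat C S) (on_classes C S (sim_zstar C S))"

definition sect_class :: "('o, 'a) cat \<Rightarrow> 'a set \<Rightarrow> 'a \<times> 'a \<Rightarrow> ('a \<times> 'a) set set" where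
  "sect_class C S p = on_classes C S (sim_a C S) `` {span_iso C S `` {p}}"

definition par_class :: "('o, 'a) cat \<Rightarrow> 'a set \<Rightarrow> 'a \<times> 'a \<Rightarrow> ('a \<times> 'a) set set" where
  "par_class C S p = on_classes C S (sim_zstar C S) `` {span_iso C S `` {p}}"

text \<open>The arrow map of \<open>\<Gamma>\<close>, which is the identity on objects. The description is unique because
  \<^term>\<open>sim_a C S \<subseteq> sim_zstar C S\<close>.\<close>

definition Gamma :: "('o, 'a) cat \<Rightarrow> 'a set \<Rightarrow> ('a \<times> 'a) set set \<Rightarrow> ('a \<times> 'a) set set" where
  "Gamma C S X = (THE Y. \<exists>p \<in> spans C S. X = sect_class C S p \<and> Y = par_class C S p)"

end

theory Submission
  imports Defs
begin

text \<open>Whiskering a span morphism pulls it back, and \<^term>\<open>S_star C S\<close> is pullback-stable by the pasting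
  lemma; hence the zigzag relation defining Par is compatible. It contains the generators of
  \<^term>\<open>approx_a C S\<close>, because a cospan morphism in \<open>S\<close> has a conjugate in \<^term>\<open>S_star C S\<close>. So
  \<open>\<Gamma>\<close> is a well-defined full functor, the identity on objects, and Par is the quotient of Sect by its
  kernel. If \<open>S\<close> consists of monomorphisms \<open>v\<close>, a cospan and its image under \<open>v\<close> have the same
  pullbacks, so all conjugates are isomorphisms and both relations collapse to isomorphism of spans.\<close>


section \<open>Categories and pullbacks\<close>

text \<open>Composition of spans is a relation: \<open>is_span_comp\<close> accepts every choice of
  pullback, so each claim about composites has to hold for all choices at once. Compatibility of
  \<open>span_iso\<close> absorbs this freedom. It comes from the same lemma as compatibility of the
  generators of the zigzag relation, the pullback-stable class being the isomorphisms in one case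
  and \<open>S_star C S\<close> in the other. This is also why \<open>S_star\<close> closes the
  conjugates under pullback: whiskering with a conjugate produces a pullback of it, which has no
  reason to be a conjugate again. The second obstacle is that both relations are equivalence
  closures. A chain of spans can be whiskered only if its intermediate spans are composable too, so
  parallelism must be carried through the closure. Finally, arrows of Sect and Par are classes of
  classes; moving a relation from spans to isomorphism classes of spans loses nothing because
  compatible relations contain \<open>span_iso\<close>.\<close>

context category
begin

lemma comp_arr [simp]: "\<lbrakk>f \<in> Arr C; g \<in> Arr C; Cod C f = Dom C g\<rbrakk> \<Longrightarrow> g \<cdot> f \<in> Arr C"
  and dom_comp [simp]: "\<lbrakk>f \<in> Arr C; g \<in> Arr C; Cod C f = Dom C g\<rbrakk> \<Longrightarrow> Dom C (g \<cdot> f) = Dom C f"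
  and cod_comp [simp]: "\<lbrakk>f \<in> Arr C; g \<in> Arr C; Cod C f = Dom C g\<rbrakk> \<Longrightarrow> Cod C (g \<cdot> f) = Cod C g"
  using comp_hom by (auto simp: Hom_def)

lemma ident_arr [simp]: "A \<in> Obj C \<Longrightarrow> Ident C A \<in> Arr C"
  and dom_ident [simp]: "A \<in> Obj C \<Longrightarrow> Dom C (Ident C A) = A"
  and cod_ident [simp]: "A \<in> Obj C \<Longrightarrow> Cod C (Ident C A) = A"
  using ident_hom by (auto simp: Hom_def)

lemmas [simp] = dom_obj cod_obj ident_left ident_right

lemma comp_ident [simp]:
  "\<lbrakk>f \<in> Arr C; Dom C f = A\<rbrakk> \<Longrightarrow> f \<cdot> Ident C A = f"
  "\<lbrakk>f \<in> Arr C; Cod C f = A\<rbrakk> \<Longrightarrow> Ident C A \<cdot> f = f"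
  by auto

lemma iso_ident: "A \<in> Obj C \<Longrightarrow> is_iso C (Ident C A)"
  by (auto simp: is_iso_def Hom_def intro!: bexI[of _ "Ident C A"])

lemma iso_comp:
  assumes "is_iso C f" "is_iso C g" "Cod C f = Dom C g"
  shows "is_iso C (g \<cdot> f)"
proof -
  obtain f' where f: "f \<in> Arr C" "f' \<in> Arr C" "Dom C f' = Cod C f" "Cod C f' = Dom C f"
      "f' \<cdot> f = Ident C (Dom C f)" "f \<cdot> f' = Ident C (Cod C f)"
    using assms(1) by (auto simp: is_iso_def Hom_def)
  obtain g' where g: "g \<in> Arr C" "g' \<in> Arr C" "Dom C g' = Cod C g" "Cod C g' = Dom C g"
      "g' \<cdot> g = Ident C (Dom C g)" "g \<cdot> g' = Ident C (Cod C g)"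
    using assms(2) by (auto simp: is_iso_def Hom_def)
  have "f' \<cdot> g' \<cdot> (g \<cdot> f) = f' \<cdot> (g' \<cdot> g \<cdot> f)"
    using f(1-4) g(1-4) assms(3) by (simp add: comp_assoc)
  then have 1: "f' \<cdot> g' \<cdot> (g \<cdot> f) = Ident C (Dom C f)"
    using f g assms(3) by simp
  have "g \<cdot> f \<cdot> (f' \<cdot> g') = g \<cdot> (f \<cdot> f' \<cdot> g')"
    using f(1-4) g(1-4) assms(3) by (simp add: comp_assoc)
  then have 2: "g \<cdot> f \<cdot> (f' \<cdot> g') = Ident C (Cod C g)"
    using f g assms(3) by simp
  show ?thesis
    unfolding is_iso_def
    using f g assms(3) 1 2 by (auto simp del: comp_assoc simp: Hom_def intro!: exI[of _ "f' \<cdot> g'"])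
qed

section \<open>Pullback squares: introduction, pasting and its converse\<close>

lemma pullback_arr:
  assumes "is_pullback C f g p q"
  shows "f \<in> Arr C" "g \<in> Arr C" "p \<in> Arr C" "q \<in> Arr C" "Cod C f = Cod C g"
    "Cod C p = Dom C f" "Cod C q = Dom C g" "Dom C p = Dom C q" "f \<cdot> p = g \<cdot> q"
  using assms by (auto simp: is_pullback_def)

lemma pullback_lift:
  assumes "is_pullback C f g p q" "a \<in> Arr C" "b \<in> Arr C" "Dom C a = Dom C b"
    "Cod C a = Dom C f" "Cod C b = Dom C g" "f \<cdot> a = g \<cdot> b"
  obtains u where "u \<in> Arr C" "Dom C u = Dom C a" "Cod C u = Dom C p" "p \<cdot> u = a" "q \<cdot> u = b"
proof -
  have "a \<in> Hom C (Dom C a) (Dom C f)" "b \<in> Hom C (Dom C a) (Dom C g)"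
    using assms by (auto simp: Hom_def)
  then have "\<exists>!u. u \<in> Hom C (Dom C a) (Dom C p) \<and> p \<cdot> u = a \<and> q \<cdot> u = b"
    using assms(1,7) unfolding is_pullback_def by blast
  then show thesis
    using that unfolding Hom_def by blast
qed

lemma pullback_cancel:
  assumes pb: "is_pullback C f g p q" and uv: "u \<in> Arr C" "v \<in> Arr C" "Dom C u = Dom C v"
    "Cod C u = Dom C p" "Cod C v = Dom C p" "p \<cdot> u = p \<cdot> v" "q \<cdot> u = q \<cdot> v"
  shows "u = v"
proof -
  note A = pullback_arr[OF pb]
  have "f \<cdot> (p \<cdot> v) = g \<cdot> (q \<cdot> v)"
    using A uv by (metis comp_assoc)
  moreover have "p \<cdot> v \<in> Hom C (Dom C v) (Dom C f)" "q \<cdot> v \<in> Hom C (Dom C v) (Dom C g)"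
    using A uv by (auto simp: Hom_def)
  ultimately have "\<exists>!u. u \<in> Hom C (Dom C v) (Dom C p) \<and> p \<cdot> u = p \<cdot> v \<and> q \<cdot> u = q \<cdot> v"
    using pb unfolding is_pullback_def by blast
  then show ?thesis using uv by (auto simp: Hom_def)
qed

text \<open>Uniqueness enters as joint cancellability of the projections, which needs no cone to be
  fixed and matches the form supplied by \<open>pullback_cancel\<close>.\<close>

lemma pullbackI:
  assumes "f \<in> Arr C" "g \<in> Arr C" "p \<in> Arr C" "q \<in> Arr C" "Cod C f = Cod C g"
    "Cod C p = Dom C f" "Cod C q = Dom C g" "Dom C p = Dom C q" "f \<cdot> p = g \<cdot> q"
    and lift: "\<And>a b. \<lbrakk>a \<in> Arr C; b \<in> Arr C; Dom C a = Dom C b; Cod C a = Dom C f;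
      Cod C b = Dom C g; f \<cdot> a = g \<cdot> b\<rbrakk> \<Longrightarrow>
      \<exists>u. u \<in> Arr C \<and> Dom C u = Dom C a \<and> Cod C u = Dom C p \<and> p \<cdot> u = a \<and> q \<cdot> u = b"
    and cancel: "\<And>u v. \<lbrakk>u \<in> Arr C; v \<in> Arr C; Dom C u = Dom C v; Cod C u = Dom C p;
      Cod C v = Dom C p; p \<cdot> u = p \<cdot> v; q \<cdot> u = q \<cdot> v\<rbrakk> \<Longrightarrow> u = v"
  shows "is_pullback C f g p q"
proof -
  have "\<exists>!u. u \<in> Hom C A (Dom C p) \<and> p \<cdot> u = a \<and> q \<cdot> u = b"
    if ab: "a \<in> Hom C A (Dom C f)" "b \<in> Hom C A (Dom C g)" "f \<cdot> a = g \<cdot> b" for A a b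
  proof (rule ex_ex1I)
    show "\<exists>u. u \<in> Hom C A (Dom C p) \<and> p \<cdot> u = a \<and> q \<cdot> u = b"
      using lift[of a b] ab by (auto simp: Hom_def)
  next
    fix u v
    assume "u \<in> Hom C A (Dom C p) \<and> p \<cdot> u = a \<and> q \<cdot> u = b"
      "v \<in> Hom C A (Dom C p) \<and> p \<cdot> v = a \<and> q \<cdot> v = b"
    then show "u = v" using cancel[of u v] by (auto simp: Hom_def)
  qed
  with assms(1-9) show ?thesis unfolding is_pullback_def by blast
qed

lemma pullback_sym:
  assumes "is_pullback C f g p q"
  shows "is_pullback C g f q p"
proof (rule pullbackI)
  fix a b
  assume ab: "a \<in> Arr C" "b \<in> Arr C" "Dom C a = Dom C b" "Cod C a = Dom C g" "Cod C b = Dom C f"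
    "g \<cdot> a = f \<cdot> b"
  obtain u where "u \<in> Arr C" "Dom C u = Dom C b" "Cod C u = Dom C p" "p \<cdot> u = b" "q \<cdot> u = a"
    using pullback_lift[OF assms ab(2,1) ab(3)[symmetric] ab(5,4) ab(6)[symmetric]] .
  then show "\<exists>u. u \<in> Arr C \<and> Dom C u = Dom C a \<and> Cod C u = Dom C q \<and> q \<cdot> u = a \<and> p \<cdot> u = b"
    using ab(3) pullback_arr(8)[OF assms] by auto
qed (use pullback_arr[OF assms] pullback_cancel[OF assms] in auto)

lemma pullback_ident:
  assumes "f \<in> Arr C"
  shows "is_pullback C f (Ident C (Cod C f)) (Ident C (Dom C f)) f"
  by (rule pullbackI) (use assms in auto)

text \<open>The square over \<open>h\<close> is glued to the square over \<open>f\<close> along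
  \<open>p\<close>; lifting and cancelling go through the square over \<open>f\<close> first and
  through the one over \<open>h\<close> second.\<close>

lemma pullback_paste:
  assumes r: "is_pullback C f g p q" and l: "is_pullback C h p a b"
  shows "is_pullback C (f \<cdot> h) g a (q \<cdot> b)"
proof -
  note A = pullback_arr[OF r] pullback_arr[OF l]
  show ?thesis
  proof (rule pullbackI)
    show "f \<cdot> h \<cdot> a = g \<cdot> (q \<cdot> b)"
      using A by (metis comp_assoc)
  next
    fix x y
    assume xy: "x \<in> Arr C" "y \<in> Arr C" "Dom C x = Dom C y" "Cod C x = Dom C (f \<cdot> h)"
      "Cod C y = Dom C g" "f \<cdot> h \<cdot> x = g \<cdot> y"
    have "f \<cdot> (h \<cdot> x) = g \<cdot> y"
      using A xy by (simp add: comp_assoc)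
    then obtain u where u: "u \<in> Arr C" "Dom C u = Dom C x" "Cod C u = Dom C p"
        "p \<cdot> u = h \<cdot> x" "q \<cdot> u = y"
      using pullback_lift[OF r, of "h \<cdot> x" y] A xy by auto
    obtain v where "v \<in> Arr C" "Dom C v = Dom C x" "Cod C v = Dom C a"
        "a \<cdot> v = x" "b \<cdot> v = u"
      using pullback_lift[OF l, of x u] A xy u by auto
    then show "\<exists>u. u \<in> Arr C \<and> Dom C u = Dom C x \<and> Cod C u = Dom C a \<and> a \<cdot> u = x
        \<and> q \<cdot> b \<cdot> u = y"
      using u A by (intro exI[of _ v]) (auto simp: comp_assoc)
  next
    fix u v
    assume uv: "u \<in> Arr C" "v \<in> Arr C" "Dom C u = Dom C v" "Cod C u = Dom C a"
      "Cod C v = Dom C a" "a \<cdot> u = a \<cdot> v" "q \<cdot> b \<cdot> u = q \<cdot> b \<cdot> v"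
    have "q \<cdot> (b \<cdot> u) = q \<cdot> (b \<cdot> v)"
      using uv A by (simp add: comp_assoc)
    moreover have "p \<cdot> (b \<cdot> u) = p \<cdot> (b \<cdot> v)"
      using uv A by (metis comp_assoc)
    ultimately have "b \<cdot> u = b \<cdot> v"
      using pullback_cancel[OF r, of "b \<cdot> u" "b \<cdot> v"] uv A by auto
    then show "u = v"
      using pullback_cancel[OF l, of u v] uv by auto
  qed (use A in auto)
qed

text \<open>The missing side \<open>b\<close> is produced by the universal property of the first
  square instead of being given. It is the arrow that whiskering induces between composites of
  spans, and it turns out to be a pullback of \<open>h\<close> along \<open>p\<close>.\<close>

lemma pullback_unpaste:
  assumes r: "is_pullback C f g p q" and o: "is_pullback C (f \<cdot> h) g a c"
    and h: "h \<in> Arr C" "Cod C h = Dom C f"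
  obtains b where "q \<cdot> b = c" "is_pullback C h p a b"
proof -
  note A = pullback_arr[OF r] pullback_arr[OF o] h
  have "f \<cdot> (h \<cdot> a) = g \<cdot> c"
    using A by (simp flip: comp_assoc)
  then obtain b where b: "b \<in> Arr C" "Dom C b = Dom C a" "Cod C b = Dom C p"
      "p \<cdot> b = h \<cdot> a" "q \<cdot> b = c"
    using pullback_lift[OF r, of "h \<cdot> a" c] A by auto
  have "is_pullback C h p a b"
  proof (rule pullbackI)
    fix x y
    assume xy: "x \<in> Arr C" "y \<in> Arr C" "Dom C x = Dom C y" "Cod C x = Dom C h"
      "Cod C y = Dom C p" "h \<cdot> x = p \<cdot> y"
    have "f \<cdot> h \<cdot> x = f \<cdot> (p \<cdot> y)"
      using A xy by (simp add: comp_assoc)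
    also have "\<dots> = g \<cdot> (q \<cdot> y)"
      using A xy by (metis comp_assoc)
    finally obtain u where u: "u \<in> Arr C" "Dom C u = Dom C x" "Cod C u = Dom C a"
        "a \<cdot> u = x" "c \<cdot> u = q \<cdot> y"
      using pullback_lift[OF o, of x "q \<cdot> y"] A xy by auto
    have "q \<cdot> (b \<cdot> u) = q \<cdot> y"
      using A b u by (metis comp_assoc)
    moreover have "p \<cdot> (b \<cdot> u) = p \<cdot> y"
      using A b u xy by (metis comp_assoc dom_comp)
    ultimately have "b \<cdot> u = y"
      using pullback_cancel[OF r, of "b \<cdot> u" y] A b u xy by auto
    then show "\<exists>u. u \<in> Arr C \<and> Dom C u = Dom C x \<and> Cod C u = Dom C a \<and> a \<cdot> u = x \<and> b \<cdot> u = y"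
      using u by blast
  next
    fix u v
    assume uv: "u \<in> Arr C" "v \<in> Arr C" "Dom C u = Dom C v" "Cod C u = Dom C a"
      "Cod C v = Dom C a" "a \<cdot> u = a \<cdot> v" "b \<cdot> u = b \<cdot> v"
    then have "c \<cdot> u = c \<cdot> v"
      using A b by (metis comp_assoc)
    then show "u = v"
      using pullback_cancel[OF o, of u v] uv by auto
  qed (use A b in auto)
  with b that show thesis by blast
qed

section \<open>Pullbacks and isomorphisms\<close>

lemma pullback_of_iso:
  assumes pb: "is_pullback C k w x h" and w: "is_iso C w"
  shows "is_iso C x"
proof -
  note A = pullback_arr[OF pb]
  obtain g where g: "g \<in> Arr C" "Dom C g = Cod C w" "Cod C g = Dom C w"
      "g \<cdot> w = Ident C (Dom C w)" "w \<cdot> g = Ident C (Cod C w)"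
    using w by (auto simp: is_iso_def Hom_def)
  have "w \<cdot> (g \<cdot> k) = k"
    using A g by (simp flip: comp_assoc)
  \<comment> \<open>The cone formed by an identity and \<open>g \<cdot> k\<close> lifts to a section
    \<open>u\<close> of \<open>x\<close>; cancelling both projections below shows that
    \<open>u\<close> is also a left inverse.\<close>
  then obtain u where u: "u \<in> Arr C" "Dom C u = Dom C k" "Cod C u = Dom C x"
      "x \<cdot> u = Ident C (Dom C k)" "h \<cdot> u = g \<cdot> k"
    using pullback_lift[OF pb, of "Ident C (Dom C k)" "g \<cdot> k"] A g by auto
  have "x \<cdot> (u \<cdot> x) = x"
    using A u by (simp flip: comp_assoc)
  moreover have "h \<cdot> (u \<cdot> x) = h"
  proof -
    have "h \<cdot> (u \<cdot> x) = (g \<cdot> k) \<cdot> x"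
      using A u by (simp flip: comp_assoc)
    also have "\<dots> = g \<cdot> (w \<cdot> h)"
      using A g by (simp add: comp_assoc)
    also have "\<dots> = h"
      using A g by (simp flip: comp_assoc)
    finally show ?thesis .
  qed
  ultimately have "u \<cdot> x = Ident C (Dom C x)"
    using pullback_cancel[OF pb, of "u \<cdot> x" "Ident C (Dom C x)"] A u by auto
  then show ?thesis
    unfolding is_iso_def using A u by (auto simp: Hom_def intro!: bexI[of _ u])
qed

lemma pullback_transport:
  assumes pb: "is_pullback C f g p q" and x: "is_iso C x" "Cod C x = Dom C p"
  shows "is_pullback C f g (p \<cdot> x) (q \<cdot> x)"
proof -
  note A = pullback_arr[OF pb]
  obtain y where y: "x \<in> Arr C" "y \<in> Arr C" "Dom C y = Cod C x" "Cod C y = Dom C x"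
      "y \<cdot> x = Ident C (Dom C x)" "x \<cdot> y = Ident C (Cod C x)"
    using x by (auto simp: is_iso_def Hom_def)
  show ?thesis
  proof (rule pullbackI)
    show "f \<cdot> (p \<cdot> x) = g \<cdot> (q \<cdot> x)"
      using A y x by (metis comp_assoc)
  next
    fix a b
    assume ab: "a \<in> Arr C" "b \<in> Arr C" "Dom C a = Dom C b" "Cod C a = Dom C f" "Cod C b = Dom C g"
      "f \<cdot> a = g \<cdot> b"
    obtain u where u: "u \<in> Arr C" "Dom C u = Dom C a" "Cod C u = Dom C p" "p \<cdot> u = a" "q \<cdot> u = b"
      using pullback_lift[OF pb ab] .
    have "x \<cdot> (y \<cdot> u) = u"
      using u x y by (simp flip: comp_assoc)
    then show "\<exists>u. u \<in> Arr C \<and> Dom C u = Dom C a \<and> Cod C u = Dom C (p \<cdot> x) \<and> p \<cdot> x \<cdot> u = a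
        \<and> q \<cdot> x \<cdot> u = b"
      using u A x y by (intro exI[of _ "y \<cdot> u"]) (auto simp: comp_assoc)
  next
    fix u v
    assume uv: "u \<in> Arr C" "v \<in> Arr C" "Dom C u = Dom C v" "Cod C u = Dom C (p \<cdot> x)"
      "Cod C v = Dom C (p \<cdot> x)" "p \<cdot> x \<cdot> u = p \<cdot> x \<cdot> v" "q \<cdot> x \<cdot> u = q \<cdot> x \<cdot> v"
    have "x \<cdot> u = x \<cdot> v"
      using pullback_cancel[OF pb, of "x \<cdot> u" "x \<cdot> v"] uv A x y by (simp add: comp_assoc)
    then have "(y \<cdot> x) \<cdot> u = (y \<cdot> x) \<cdot> v"
      using uv A x y by (metis comp_assoc dom_comp)
    then show "u = v"
      using uv A x y by simp
  qed (use A x y in auto)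
qed

lemma pullback_unique:
  assumes "is_pullback C f g p q" "is_pullback C f g p' q'"
  obtains x where "is_iso C x" "Dom C x = Dom C p" "Cod C x = Dom C p'" "p' \<cdot> x = p" "q' \<cdot> x = q"
proof -
  note A = pullback_arr[OF assms(1)] pullback_arr[OF assms(2)]
  obtain x where x: "x \<in> Arr C" "Dom C x = Dom C p" "Cod C x = Dom C p'" "p' \<cdot> x = p" "q' \<cdot> x = q"
    using pullback_lift[OF assms(2), of p q] A by auto
  obtain y where y: "y \<in> Arr C" "Dom C y = Dom C p'" "Cod C y = Dom C p" "p \<cdot> y = p'" "q \<cdot> y = q'"
    using pullback_lift[OF assms(1), of p' q'] A by auto
  have "p' \<cdot> (x \<cdot> y) = p'" "q' \<cdot> (x \<cdot> y) = q'" "p \<cdot> (y \<cdot> x) = p" "q \<cdot> (y \<cdot> x) = q"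
    using A x y by (simp_all flip: comp_assoc)
  then have "x \<cdot> y = Ident C (Dom C p')" "y \<cdot> x = Ident C (Dom C p)"
    using pullback_cancel[OF assms(2), of "x \<cdot> y" "Ident C (Dom C p')"]
      pullback_cancel[OF assms(1), of "y \<cdot> x" "Ident C (Dom C p)"] A x y by auto
  then have "is_iso C x"
    unfolding is_iso_def using x y by (auto simp: Hom_def intro!: bexI[of _ y])
  with x that show thesis by blast
qed

end


section \<open>Quotient categories\<close>

text \<open>Composition is tested with both factors varying at once, which is what makes the union
  in \<open>Comp\<close> of \<open>quotient_category\<close> constant over representatives.\<close>

definition congruence :: "('o, 'a) cat \<Rightarrow> ('a \<times> 'a) set \<Rightarrow> bool" where
  "congruence C R \<longleftrightarrow> equiv (Arr C) R \<and>
     (\<forall>(f, g) \<in> R. Dom C f = Dom C g \<and> Cod C f = Cod C g) \<and>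
     (\<forall>(f, f') \<in> R. \<forall>(g, g') \<in> R. Cod C f = Dom C g \<longrightarrow> (g \<cdot>\<^bsub>C\<^esub> f, g' \<cdot>\<^bsub>C\<^esub> f') \<in> R)"

lemma congruenceD:
  assumes "congruence C R"
  shows "equiv (Arr C) R"
    "(f, g) \<in> R \<Longrightarrow> f \<in> Arr C" "(f, g) \<in> R \<Longrightarrow> g \<in> Arr C"
    "(f, g) \<in> R \<Longrightarrow> Dom C f = Dom C g" "(f, g) \<in> R \<Longrightarrow> Cod C f = Cod C g"
    "\<lbrakk>(f, f') \<in> R; (g, g') \<in> R; Cod C f = Dom C g\<rbrakk> \<Longrightarrow> (g \<cdot>\<^bsub>C\<^esub> f, g' \<cdot>\<^bsub>C\<^esub> f') \<in> R"
    "f \<in> Arr C \<Longrightarrow> (f, f) \<in> R"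
proof -
  show eq: "equiv (Arr C) R"
    using assms unfolding congruence_def by blast
  show "(f, g) \<in> R \<Longrightarrow> f \<in> Arr C" "(f, g) \<in> R \<Longrightarrow> g \<in> Arr C" "f \<in> Arr C \<Longrightarrow> (f, f) \<in> R"
    using eq by (auto elim!: equivE simp: refl_on_def)
  show "(f, g) \<in> R \<Longrightarrow> Dom C f = Dom C g" "(f, g) \<in> R \<Longrightarrow> Cod C f = Cod C g"
    "\<lbrakk>(f, f') \<in> R; (g, g') \<in> R; Cod C f = Dom C g\<rbrakk> \<Longrightarrow> (g \<cdot>\<^bsub>C\<^esub> f, g' \<cdot>\<^bsub>C\<^esub> f') \<in> R"
    using assms unfolding congruence_def by blast+
qed

text \<open>\<open>Dom\<close> and \<open>Cod\<close> of a quotient are the unique element of the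
  image of a class, so they are computed by showing a function constant on the class; the
  representative itself makes the image nonempty.\<close>

lemma the_elem_image_class:
  assumes "equiv A R" "a \<in> A" "\<And>b. (a, b) \<in> R \<Longrightarrow> F b = F a"
  shows "the_elem (F ` (R `` {a})) = F a"
proof -
  have "F ` (R `` {a}) = {F a}"
  proof
    show "F ` (R `` {a}) \<subseteq> {F a}"
      using assms(3) by blast
    show "{F a} \<subseteq> F ` (R `` {a})"
      using equiv_class_self[OF assms(1,2)] by blast
  qed
  then show ?thesis by simp
qed

context category
begin

context
  fixes R
  assumes R: "congruence C R"
begin

private abbreviation "Q \<equiv> quotient_category C R"

lemma quotient_arr: "f \<in> Arr C \<Longrightarrow> R `` {f} \<in> Arr Q"
  by (auto simp: quotient_category_def quotient_def)

lemma quotient_arrE: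
  assumes "X \<in> Arr Q" obtains f where "f \<in> Arr C" "X = R `` {f}"
  using assms by (auto simp: quotient_category_def quotient_def)

lemma quotient_class_eq:
  "f \<in> Arr C \<Longrightarrow> g \<in> Arr C \<Longrightarrow> R `` {f} = R `` {g} \<longleftrightarrow> (f, g) \<in> R"
  using eq_equiv_class_iff[OF congruenceD(1)[OF R]] .

lemma quotient_obj: "Obj Q = Obj C"
  by (simp add: quotient_category_def)

lemma quotient_dom: "f \<in> Arr C \<Longrightarrow> Dom Q (R `` {f}) = Dom C f"
  and quotient_cod: "f \<in> Arr C \<Longrightarrow> Cod Q (R `` {f}) = Cod C f"
  by (simp_all add: quotient_category_def
      the_elem_image_class[OF congruenceD(1)[OF R] _ congruenceD(4)[OF R, symmetric]]
      the_elem_image_class[OF congruenceD(1)[OF R] _ congruenceD(5)[OF R, symmetric]])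

lemma quotient_ident: "Ident Q A = R `` {Ident C A}"
  by (simp add: quotient_category_def)

lemma quotient_comp:
  assumes "f \<in> Arr C" "g \<in> Arr C" "Cod C f = Dom C g"
  shows "R `` {g} \<cdot>\<^bsub>Q\<^esub> R `` {f} = R `` {g \<cdot> f}"
proof -
  have "R `` {g' \<cdot> f'} = R `` {g \<cdot> f}" if "(g, g') \<in> R" "(f, f') \<in> R" for g' f'
    using congruenceD(6)[OF R that(2,1) assms(3)] equiv_class_eq[OF congruenceD(1)[OF R]] by metis
  then have "R `` {g} \<cdot>\<^bsub>Q\<^esub> R `` {f} = (\<Union>g' \<in> R `` {g}. \<Union>f' \<in> R `` {f}. R `` {g \<cdot> f})"
    by (simp add: quotient_category_def)
  \<comment> \<open>A union over a constant family equals that constant only if the index classes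
    are inhabited.\<close>
  moreover have "R `` {g} \<noteq> {}" "R `` {f} \<noteq> {}"
    using equiv_class_self[OF congruenceD(1)[OF R]] assms by blast+
  ultimately show ?thesis by simp
qed

lemmas quotient_simps = quotient_arr quotient_dom quotient_cod quotient_ident quotient_comp quotient_obj

lemma category_quotient: "category Q"
proof
  fix X assume "X \<in> Arr Q"
  then obtain f where "f \<in> Arr C" "X = R `` {f}" by (rule quotient_arrE)
  then show "Dom Q X \<in> Obj Q" "Cod Q X \<in> Obj Q" "X \<cdot>\<^bsub>Q\<^esub> Ident Q (Dom Q X) = X"
      "Ident Q (Cod Q X) \<cdot>\<^bsub>Q\<^esub> X = X"
    by (simp_all add: quotient_simps)
next
  fix A assume "A \<in> Obj Q"
  then show "Ident Q A \<in> Hom Q A A"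
    by (simp add: quotient_simps Hom_def)
next
  fix X Y assume X: "X \<in> Arr Q" and Y: "Y \<in> Arr Q" and c: "Cod Q X = Dom Q Y"
  obtain f where f: "f \<in> Arr C" "X = R `` {f}" using X by (rule quotient_arrE)
  obtain g where g: "g \<in> Arr C" "Y = R `` {g}" using Y by (rule quotient_arrE)
  show "Y \<cdot>\<^bsub>Q\<^esub> X \<in> Hom Q (Dom Q X) (Cod Q Y)"
    using f g c by (simp add: quotient_simps Hom_def)
next
  fix X Y Z
  assume X: "X \<in> Arr Q" and Y: "Y \<in> Arr Q" and Z: "Z \<in> Arr Q"
    and c: "Cod Q X = Dom Q Y" "Cod Q Y = Dom Q Z"
  obtain f where f: "f \<in> Arr C" "X = R `` {f}" using X by (rule quotient_arrE)
  obtain g where g: "g \<in> Arr C" "Y = R `` {g}" using Y by (rule quotient_arrE)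
  obtain h where h: "h \<in> Arr C" "Z = R `` {h}" using Z by (rule quotient_arrE)
  show "Z \<cdot>\<^bsub>Q\<^esub> Y \<cdot>\<^bsub>Q\<^esub> X = Z \<cdot>\<^bsub>Q\<^esub> (Y \<cdot>\<^bsub>Q\<^esub> X)"
    using f g h c by (simp add: quotient_simps comp_assoc)
qed

end

text \<open>The equation for \<open>F\<close> forces \<open>R\<close> to be contained in
  \<open>R'\<close>, since \<open>F\<close> assigns a single value to each class of
  \<open>R\<close>.\<close>

lemma functor_quotient_mono:
  assumes R: "congruence C R" and R': "congruence C R'"
    and F: "\<And>f. f \<in> Arr C \<Longrightarrow> F (R `` {f}) = R' `` {f}"
  shows "is_functor (quotient_category C R) (quotient_category C R') (\<lambda>A. A) F"
proof -
  note simps = quotient_simps[OF R] quotient_simps[OF R'] Hom_def F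
  have "F (Y \<cdot>\<^bsub>quotient_category C R\<^esub> X) = F Y \<cdot>\<^bsub>quotient_category C R'\<^esub> F X"
    if XY: "X \<in> Arr (quotient_category C R)" "Y \<in> Arr (quotient_category C R)"
      "Cod (quotient_category C R) X = Dom (quotient_category C R) Y" for X Y
  proof -
    obtain f where f: "f \<in> Arr C" "X = R `` {f}" using XY(1) by (rule quotient_arrE[OF R])
    obtain g where g: "g \<in> Arr C" "Y = R `` {g}" using XY(2) by (rule quotient_arrE[OF R])
    show ?thesis
      using f g XY(3) by (simp add: simps)
  qed
  then show ?thesis
    unfolding is_functor_def
    using category_quotient[OF R] category_quotient[OF R']
    by (auto simp: simps elim!: quotient_arrE[OF R])
qed

end

section \<open>Isomorphisms of categories\<close>

lemma isomorphic_categories_sym: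
  "isomorphic_categories C D \<Longrightarrow> isomorphic_categories D C"
  unfolding isomorphic_categories_def by (elim exE conjE) (intro exI conjI)

text \<open>The set-theoretic inverses of a functor that is bijective on objects and on arrows form
  a functor: every identity and every composite of \<open>D\<close> is the image under
  \<open>Fa\<close> of one in \<open>C\<close>.\<close>

lemma isomorphic_categoriesI:
  assumes F: "is_functor C D Fo Fa"
    and bo: "bij_betw Fo (Obj C) (Obj D)" and ba: "bij_betw Fa (Arr C) (Arr D)"
  shows "isomorphic_categories C D"
proof -
  interpret C: category C using F by (simp add: is_functor_def)
  interpret D: category D using F by (simp add: is_functor_def)
  define Go where "Go = inv_into (Obj C) Fo"
  define Ga where "Ga = inv_into (Arr C) Fa"
  have Go: "A \<in> Obj C \<Longrightarrow> Go (Fo A) = A" "B \<in> Obj D \<Longrightarrow> Fo (Go B) = B" "B \<in> Obj D \<Longrightarrow> Go B \<in> Obj C"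
    for A B
    unfolding Go_def using bo
    by (auto simp: bij_betw_inv_into_left bij_betw_inv_into_right
        intro: bij_betw_apply[OF bij_betw_inv_into])
  have Ga: "f \<in> Arr C \<Longrightarrow> Ga (Fa f) = f" "g \<in> Arr D \<Longrightarrow> Fa (Ga g) = g" "g \<in> Arr D \<Longrightarrow> Ga g \<in> Arr C"
    for f g
    unfolding Ga_def using ba
    by (auto simp: bij_betw_inv_into_left bij_betw_inv_into_right
        intro: bij_betw_apply[OF bij_betw_inv_into])
  have FD: "Fa f \<in> Arr D" "Dom D (Fa f) = Fo (Dom C f)" "Cod D (Fa f) = Fo (Cod C f)"
    if "f \<in> Arr C" for f
    using F that by (auto simp: is_functor_def Hom_def)
  have Fi: "Fa (Ident C A) = Ident D (Fo A)" if "A \<in> Obj C" for A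
    using F that by (auto simp: is_functor_def)
  have Fc: "Fa (g \<cdot>\<^bsub>C\<^esub> f) = Fa g \<cdot>\<^bsub>D\<^esub> Fa f" if "f \<in> Arr C" "g \<in> Arr C" "Cod C f = Dom C g" for f g
    using F that by (auto simp: is_functor_def)
  \<comment> \<open>Endpoints come first: composability of \<open>Ga f\<close> and
    \<open>Ga g\<close> in \<open>C\<close> must be known before \<open>Fc\<close> applies to
    them.\<close>
  have GD: "Dom C (Ga g) = Go (Dom D g)" "Cod C (Ga g) = Go (Cod D g)" if "g \<in> Arr D" for g
    using FD(2,3)[of "Ga g"] Ga Go that by (metis C.dom_obj C.cod_obj)+
  have "Ga (Ident D B) = Ident C (Go B)" if "B \<in> Obj D" for B
    using Fi[of "Go B"] Ga Go that by (metis C.ident_arr)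
  moreover have "Ga (g \<cdot>\<^bsub>D\<^esub> f) = Ga g \<cdot>\<^bsub>C\<^esub> Ga f"
    if "f \<in> Arr D" "g \<in> Arr D" "Cod D f = Dom D g" for f g
  proof -
    have "Cod C (Ga f) = Dom C (Ga g)"
      using GD that by simp
    then show ?thesis
      using Fc[of "Ga f" "Ga g"] Ga that by (metis C.comp_arr)
  qed
  ultimately have "is_functor D C Go Ga"
    unfolding is_functor_def Hom_def using C.category_axioms D.category_axioms Go Ga GD by auto
  then show ?thesis
    unfolding isomorphic_categories_def using F Go Ga by blast
qed

lemma isomorphic_categories_refl: "category C \<Longrightarrow> isomorphic_categories C C"
  by (rule isomorphic_categoriesI[where Fo = "\<lambda>A. A" and Fa = "\<lambda>f. f"])
    (auto simp: is_functor_def Hom_def category.comp_arr category.dom_obj category.cod_obj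
      intro: bij_betw_imageI)

section \<open>Kernels of functors and the trivial quotient\<close>

lemma (in category) congruence_induced:
  assumes F: "is_functor C D Fo Fa"
  shows "congruence C (induced_congruence C Fa)"
proof -
  interpret D: category D using F by (simp add: is_functor_def)
  have "Fa (g \<cdot> f) = Fa g \<cdot>\<^bsub>D\<^esub> Fa f" if "f \<in> Arr C" "g \<in> Arr C" "Cod C f = Dom C g" for f g
    using F that unfolding is_functor_def by blast
  then show ?thesis
    unfolding congruence_def induced_congruence_def
    by (intro conjI equivI) (auto simp: refl_on_def sym_def trans_def)
qed

text \<open>A first isomorphism theorem: for a functor that is the identity on objects, surjectivity
  on arrows is fullness, and the map induced on the quotient by the kernel is bijective. The induced
  map \<open>?G\<close> evaluates \<open>Fa\<close> at any representative.\<close>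

lemma (in category) full_functor_iso_quotient:
  assumes F: "is_functor C D (\<lambda>A. A) Fa" and obj: "Obj C = Obj D"
    and surj: "Arr D \<subseteq> Fa ` Arr C"
  shows "isomorphic_categories D (quotient_category C (induced_congruence C Fa))"
proof -
  define R where "R = induced_congruence C Fa"
  have R: "congruence C R"
    unfolding R_def using F by (rule congruence_induced)
  let ?Q = "quotient_category C R"
  let ?G = "\<lambda>X. the_elem (Fa ` X)"
  note simps = quotient_simps[OF R] Hom_def
  have FD: "Fa f \<in> Arr D" "Dom D (Fa f) = Dom C f" "Cod D (Fa f) = Cod C f"
    if "f \<in> Arr C" for f
    using F that by (auto simp: is_functor_def Hom_def)
  \<comment> \<open>Since \<open>Fa\<close> preserves endpoints, equal images already force parallel
    arrows, so \<open>R\<close> is just equality of images.\<close>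
  have Rin: "(f, g) \<in> R \<longleftrightarrow> f \<in> Arr C \<and> g \<in> Arr C \<and> Fa f = Fa g" for f g
    using FD(2,3) unfolding R_def induced_congruence_def by auto metis+
  have G: "?G (R `` {f}) = Fa f" if "f \<in> Arr C" for f
    using the_elem_image_class[OF congruenceD(1)[OF R] that, of Fa] by (auto simp: Rin)
  have comp: "?G (Y \<cdot>\<^bsub>?Q\<^esub> X) = ?G Y \<cdot>\<^bsub>D\<^esub> ?G X"
    if XY: "X \<in> Arr ?Q" "Y \<in> Arr ?Q" "Cod ?Q X = Dom ?Q Y" for X Y
  proof -
    obtain f where f: "f \<in> Arr C" "X = R `` {f}" using XY(1) by (rule quotient_arrE[OF R])
    obtain g where g: "g \<in> Arr C" "Y = R `` {g}" using XY(2) by (rule quotient_arrE[OF R])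
    have "Fa (g \<cdot> f) = Fa g \<cdot>\<^bsub>D\<^esub> Fa f"
      using F f g XY(3) by (simp add: simps is_functor_def)
    then show ?thesis
      using f g XY(3) by (simp add: simps G)
  qed
  have "\<forall>A \<in> Obj ?Q. ?G (Ident ?Q A) = Ident D A"
    using F by (simp add: simps G is_functor_def)
  with comp have func: "is_functor ?Q D (\<lambda>A. A) ?G"
    unfolding is_functor_def using category_quotient[OF R] F obj
    by (auto simp: simps G FD is_functor_def elim!: quotient_arrE[OF R])
  have inj: "inj_on ?G (Arr ?Q)"
  proof (rule inj_onI)
    fix X Y assume XY: "X \<in> Arr ?Q" "Y \<in> Arr ?Q" "?G X = ?G Y"
    obtain f where f: "f \<in> Arr C" "X = R `` {f}" using XY(1) by (rule quotient_arrE[OF R])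
    obtain g where g: "g \<in> Arr C" "Y = R `` {g}" using XY(2) by (rule quotient_arrE[OF R])
    show "X = Y"
      using XY(3) f g by (simp add: G Rin quotient_class_eq[OF R])
  qed
  have "?G ` Arr ?Q = Arr D"
  proof
    show "?G ` Arr ?Q \<subseteq> Arr D"
      by (auto simp: G FD elim!: quotient_arrE[OF R])
    show "Arr D \<subseteq> ?G ` Arr ?Q"
    proof
      fix g assume "g \<in> Arr D"
      then obtain f where "f \<in> Arr C" "g = Fa f" using surj by auto
      then show "g \<in> ?G ` Arr ?Q"
        by (auto simp: G quotient_arr[OF R] intro!: image_eqI[of _ _ "R `` {f}"])
    qed
  qed
  with inj have "isomorphic_categories ?Q D"
    by (intro isomorphic_categoriesI[OF func]) (auto simp: bij_betw_def simps obj)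
  then show ?thesis
    unfolding R_def by (rule isomorphic_categories_sym)
qed

text \<open>The arrows of this quotient are singleton classes, so the two categories have different
  arrow types and are compared by an isomorphism instead of an equation.\<close>

lemma (in category) quotient_Id_iso:
  "isomorphic_categories (quotient_category C (Id_on (Arr C))) C"
proof -
  let ?R = "Id_on (Arr C)" let ?Q = "quotient_category C ?R"
  have R: "congruence C ?R"
    by (auto simp: congruence_def intro!: equivI simp: refl_on_def sym_def trans_def)
  have "is_functor C ?Q (\<lambda>A. A) (\<lambda>f. ?R `` {f})"
    unfolding is_functor_def using category_quotient[OF R] category_axioms
    by (auto simp: quotient_simps[OF R] Hom_def simp del: Image_Id_on)
  moreover have "bij_betw (\<lambda>f. ?R `` {f}) (Arr C) (Arr ?Q)"
    using quotient_class_eq[OF R]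
    by (auto simp: bij_betw_def inj_on_def quotient_arr[OF R] simp del: Image_Id_on
        elim!: quotient_arrE[OF R])
  ultimately show ?thesis
    by (intro isomorphic_categories_sym[OF isomorphic_categoriesI]) 
      (auto simp: quotient_obj[OF R] intro: bij_betw_imageI)
qed

section \<open>Equivalence relations generated by a relation\<close>

lemma equiv_generated_equiv:
  assumes "R \<subseteq> A \<times> A"
  shows "equiv A (generated_equiv A R)"
proof -
  \<comment> \<open>The hypothesis on \<open>R\<close> makes \<open>A \<times> A\<close> a member of
    the intersected family, which keeps the intersection inside \<open>A \<times> A\<close>.\<close>
  have "equiv A (A \<times> A)"
    by (auto intro!: equivI simp: refl_on_def sym_def trans_def)
  then have "generated_equiv A R \<subseteq> A \<times> A"
    using assms unfolding generated_equiv_def by blast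
  moreover have "refl_on A (generated_equiv A R)"
    unfolding generated_equiv_def by (auto simp: equiv_def refl_on_def)
  moreover have "sym (generated_equiv A R)"
    unfolding generated_equiv_def by (auto simp: equiv_def intro!: symI dest: symD)
  moreover have "trans (generated_equiv A R)"
    unfolding generated_equiv_def by (auto simp: equiv_def intro!: transI dest: transD)
  ultimately show ?thesis by (intro equivI)
qed

lemma generated_equiv_upper: "R \<subseteq> generated_equiv A R"
  unfolding generated_equiv_def by blast

lemma generated_equiv_least: "equiv A E \<Longrightarrow> R \<subseteq> E \<Longrightarrow> generated_equiv A R \<subseteq> E"
  unfolding generated_equiv_def by blast


section \<open>Spans\<close>

lemma compatibleI:
  assumes "\<And>p q. (p, q) \<in> R \<Longrightarrow> p \<in> spans C S \<and> q \<in> spans C S \<and>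
      Cod C (fst p) = Cod C (fst q) \<and> Cod C (snd p) = Cod C (snd q)"
    and "span_iso C S \<subseteq> R"
    and "\<And>p q r p' q'. \<lbrakk>(p, q) \<in> R; r \<in> spans C S; is_span_comp C r p p'; is_span_comp C r q q'\<rbrakk>
      \<Longrightarrow> (p', q') \<in> R"
    and "\<And>p q r p' q'. \<lbrakk>(p, q) \<in> R; r \<in> spans C S; is_span_comp C p r p'; is_span_comp C q r q'\<rbrakk>
      \<Longrightarrow> (p', q') \<in> R"
  shows "compatible C S R"
  unfolding compatible_def using assms by blast

lemma compatibleD:
  assumes "compatible C S R"
  shows "(p, q) \<in> R \<Longrightarrow> p \<in> spans C S" "(p, q) \<in> R \<Longrightarrow> q \<in> spans C S"
    "(p, q) \<in> R \<Longrightarrow> Cod C (fst p) = Cod C (fst q)"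
    "(p, q) \<in> R \<Longrightarrow> Cod C (snd p) = Cod C (snd q)"
    "span_iso C S \<subseteq> R"
    "\<lbrakk>(p, q) \<in> R; r \<in> spans C S; is_span_comp C r p p'; is_span_comp C r q q'\<rbrakk> \<Longrightarrow> (p', q') \<in> R"
    "\<lbrakk>(p, q) \<in> R; r \<in> spans C S; is_span_comp C p r p'; is_span_comp C q r q'\<rbrakk> \<Longrightarrow> (p', q') \<in> R"
  using assms unfolding compatible_def by blast+

text \<open>The family must be inhabited because the empty intersection is the universal relation,
  which need not relate only parallel spans.\<close>

lemma compatible_Inter:
  assumes ne: "\<R> \<noteq> {}" and comp: "\<And>R. R \<in> \<R> \<Longrightarrow> compatible C S R"
  shows "compatible C S (\<Inter>\<R>)"
proof (rule compatibleI)
  fix p q assume "(p, q) \<in> \<Inter>\<R>"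
  then obtain R where R: "R \<in> \<R>" "(p, q) \<in> R"
    using ne by blast
  then show "p \<in> spans C S \<and> q \<in> spans C S \<and>
      Cod C (fst p) = Cod C (fst q) \<and> Cod C (snd p) = Cod C (snd q)"
    using compatibleD(1-4)[OF comp[OF R(1)] R(2)] by blast
next
  show "span_iso C S \<subseteq> \<Inter>\<R>"
    using compatibleD(5)[OF comp] by blast
next
  fix p q r p' q'
  assume "(p, q) \<in> \<Inter>\<R>" "r \<in> spans C S" "is_span_comp C r p p'" "is_span_comp C r q q'"
  then show "(p', q') \<in> \<Inter>\<R>"
    using compatibleD(6)[OF comp] by blast
next
  fix p q r p' q'
  assume "(p, q) \<in> \<Inter>\<R>" "r \<in> spans C S" "is_span_comp C p r p'" "is_span_comp C q r q'"
  then show "(p', q') \<in> \<Inter>\<R>"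
    using compatibleD(7)[OF comp] by blast
qed

context span_setting
begin

lemma spansD:
  assumes "p \<in> spans C S"
  shows "fst p \<in> S" "fst p \<in> Arr C" "snd p \<in> Arr C" "Dom C (snd p) = Dom C (fst p)"
  using assms S_arr by (auto simp: spans_def)

lemma ident_S: "A \<in> Obj C \<Longrightarrow> Ident C A \<in> S"
  using S_iso iso_ident by blast

lemma ident_span: "A \<in> Obj C \<Longrightarrow> (Ident C A, Ident C A) \<in> spans C S"
  by (simp add: spans_def ident_S)

lemma span_morD:
  assumes "is_span_mor C x p q"
  shows "x \<in> Arr C" "Dom C x = Dom C (fst p)" "Cod C x = Dom C (fst q)"
    "fst q \<cdot> x = fst p" "snd q \<cdot> x = snd p"
  using assms by (auto simp: is_span_mor_def Hom_def)

lemma span_mor_parallel: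
  assumes "is_span_mor C x p q" "p \<in> spans C S" "q \<in> spans C S"
  shows "Cod C (fst p) = Cod C (fst q)" "Cod C (snd p) = Cod C (snd q)"
  using span_morD[OF assms(1)] spansD[OF assms(2)] spansD[OF assms(3)] cod_comp by metis+

lemma span_mor_ident:
  "p \<in> spans C S \<Longrightarrow> is_span_mor C (Ident C (Dom C (fst p))) p p"
  using spansD[of p] by (auto simp: is_span_mor_def Hom_def)

lemma span_mor_comp:
  assumes x: "is_span_mor C x p q" and y: "is_span_mor C y q r"
    and q: "q \<in> spans C S" and r: "r \<in> spans C S"
  shows "is_span_mor C (y \<cdot> x) p r"
proof -
  note A = span_morD[OF x] span_morD[OF y] spansD[OF q] spansD[OF r]
  have "fst r \<cdot> (y \<cdot> x) = fst p" "snd r \<cdot> (y \<cdot> x) = snd p"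
    using A by (simp_all flip: comp_assoc)
  then show ?thesis
    using A by (auto simp: is_span_mor_def Hom_def)
qed

lemma equiv_span_iso: "equiv (spans C S) (span_iso C S)"
proof (rule equivI)
  show "span_iso C S \<subseteq> spans C S \<times> spans C S"
    by (auto simp: span_iso_def)
  show "refl_on (spans C S) (span_iso C S)"
    using span_mor_ident iso_ident dom_obj spansD(2) unfolding refl_on_def span_iso_def by blast
  show "sym (span_iso C S)"
  proof (rule symI)
    fix p q assume "(p, q) \<in> span_iso C S"
    then obtain x where pq: "p \<in> spans C S" "q \<in> spans C S" and x: "is_iso C x" "is_span_mor C x p q"
      by (auto simp: span_iso_def)
    note A = span_morD[OF x(2)] spansD[OF pq(1)] spansD[OF pq(2)]
    obtain y where y: "y \<in> Arr C" "Dom C y = Cod C x" "Cod C y = Dom C x"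
        "y \<cdot> x = Ident C (Dom C x)" "x \<cdot> y = Ident C (Cod C x)"
      using x(1) by (auto simp: is_iso_def Hom_def)
    have "fst p \<cdot> y = fst q \<cdot> (x \<cdot> y)" "snd p \<cdot> y = snd q \<cdot> (x \<cdot> y)"
      using A y(1-3) by (simp_all flip: comp_assoc)
    then have "is_span_mor C y q p"
      using A y by (auto simp: is_span_mor_def Hom_def)
    moreover have "is_iso C y"
      using A y by (auto simp: is_iso_def Hom_def intro!: exI[of _ x])
    ultimately show "(q, p) \<in> span_iso C S"
      using pq by (auto simp: span_iso_def)
  qed
  show "trans (span_iso C S)"
  proof (rule transI)
    fix p q r assume "(p, q) \<in> span_iso C S" "(q, r) \<in> span_iso C S"
    then obtain x y where s: "p \<in> spans C S" "q \<in> spans C S" "r \<in> spans C S"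
      and x: "is_iso C x" "is_span_mor C x p q" and y: "is_iso C y" "is_span_mor C y q r"
      by (auto simp: span_iso_def)
    have "is_iso C (y \<cdot> x)"
      using iso_comp[OF x(1) y(1)] span_morD[OF x(2)] span_morD[OF y(2)] by simp
    with span_mor_comp[OF x(2) y(2) s(2,3)] s show "(p, r) \<in> span_iso C S"
      by (auto simp: span_iso_def)
  qed
qed

section \<open>Composition and whiskering of spans\<close>

lemma span_comp_exists:
  assumes "p \<in> spans C S" "q \<in> spans C S" "Cod C (snd p) = Cod C (fst q)"
  obtains r where "is_span_comp C q p r"
  using S_pullback_exists[of "fst q" "snd p"] spansD[OF assms(1)] spansD[OF assms(2)] assms(3)
  unfolding is_span_comp_def by blast

lemma span_comp_spans:
  assumes p: "p \<in> spans C S" and q: "q \<in> spans C S" and r: "is_span_comp C q p r"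
  shows "r \<in> spans C S" "Cod C (fst r) = Cod C (fst p)" "Cod C (snd r) = Cod C (snd q)"
    "Cod C (snd p) = Cod C (fst q)"
proof -
  obtain t f where pb: "is_pullback C (snd p) (fst q) t f"
    and r: "r = (fst p \<cdot> t, snd q \<cdot> f)"
    using r by (auto simp: is_span_comp_def)
  note A = pullback_arr[OF pb] spansD[OF p] spansD[OF q]
  have "fst p \<cdot> t \<in> S"
    using S_comp[OF S_pullback[OF _ pb]] A by simp
  then show "r \<in> spans C S" "Cod C (fst r) = Cod C (fst p)" "Cod C (snd r) = Cod C (snd q)"
      "Cod C (snd p) = Cod C (fst q)"
    using A by (auto simp: r spans_def)
qed

text \<open>The arrow \<open>y\<close> between the apexes comes from the universal property of the
  second composite, and unpasting identifies it as a pullback of \<open>x\<close> along the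
  projection \<open>t'\<close>.\<close>

lemma span_comp_mor_right:
  assumes x: "is_span_mor C x p p'" and s: "p \<in> spans C S" "p' \<in> spans C S" "r \<in> spans C S"
    and q: "is_span_comp C r p q" "is_span_comp C r p' q'"
  obtains y k h where "is_span_mor C y q q'" "is_pullback C k x y h"
proof -
  obtain t f where pb: "is_pullback C (snd p) (fst r) t f" and q: "q = (fst p \<cdot> t, snd r \<cdot> f)"
    using q(1) by (auto simp: is_span_comp_def)
  obtain t' f' where pb': "is_pullback C (snd p') (fst r) t' f'" and q': "q' = (fst p' \<cdot> t', snd r \<cdot> f')"
    using assms(6) by (auto simp: is_span_comp_def)
  note X = span_morD[OF x]
  \<comment> \<open>As \<open>snd p = snd p' \<cdot> x\<close>, the square \<open>pb\<close> is an
    outer rectangle over \<open>pb'\<close>, which is what unpasting requires.\<close>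
  obtain y where y: "f' \<cdot> y = f" "is_pullback C x t' t y"
    using pullback_unpaste[OF pb', of x t f] pb X spansD[OF s(2)] by auto
  note A = X pullback_arr[OF pb] pullback_arr[OF pb'] pullback_arr[OF y(2)]
    spansD[OF s(1)] spansD[OF s(2)] spansD[OF s(3)]
  have "fst p' \<cdot> t' \<cdot> y = fst p' \<cdot> (x \<cdot> t)"
    using A by (simp add: comp_assoc)
  also have "\<dots> = fst p' \<cdot> x \<cdot> t"
    by (rule comp_assoc[symmetric]) (use A in simp_all)
  also have "\<dots> = fst p \<cdot> t"
    using X by simp
  finally have "fst p' \<cdot> t' \<cdot> y = fst p \<cdot> t" .
  moreover have "snd r \<cdot> f' \<cdot> y = snd r \<cdot> f"
    using A y(1) by (simp add: comp_assoc)
  ultimately have "is_span_mor C y q q'"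
    using A by (auto simp: is_span_mor_def Hom_def q q')
  with pullback_sym[OF y(2)] that show thesis by blast
qed

lemma span_comp_mor_left:
  assumes x: "is_span_mor C x p p'" and s: "p \<in> spans C S" "p' \<in> spans C S" "r \<in> spans C S"
    and q: "is_span_comp C p r q" "is_span_comp C p' r q'"
  obtains y k h where "is_span_mor C y q q'" "is_pullback C k x y h"
proof -
  obtain t f where pb: "is_pullback C (snd r) (fst p) t f" and q: "q = (fst r \<cdot> t, snd p \<cdot> f)"
    using q(1) by (auto simp: is_span_comp_def)
  obtain t' f' where pb': "is_pullback C (snd r) (fst p') t' f'" and q': "q' = (fst r \<cdot> t', snd p' \<cdot> f')"
    using assms(6) by (auto simp: is_span_comp_def)
  note X = span_morD[OF x]
  \<comment> \<open>Here \<open>x\<close> acts on the other leg,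
    \<open>fst p = fst p' \<cdot> x\<close>, so both squares are transposed before unpasting, and
    \<open>y\<close> is a pullback of \<open>x\<close> along \<open>f'\<close>.\<close>
  obtain y where y: "t' \<cdot> y = t" "is_pullback C x f' f y"
    using pullback_unpaste[OF pullback_sym[OF pb'], of x f t] pullback_sym[OF pb] X spansD[OF s(2)]
    by auto
  note A = X pullback_arr[OF pb] pullback_arr[OF pb'] pullback_arr[OF y(2)]
    spansD[OF s(1)] spansD[OF s(2)] spansD[OF s(3)]
  have "snd p' \<cdot> f' \<cdot> y = snd p' \<cdot> (x \<cdot> f)"
    using A by (simp add: comp_assoc)
  also have "\<dots> = snd p' \<cdot> x \<cdot> f"
    by (rule comp_assoc[symmetric]) (use A in simp_all)
  also have "\<dots> = snd p \<cdot> f"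
    using X by simp
  finally have "snd p' \<cdot> f' \<cdot> y = snd p \<cdot> f" .
  moreover have "fst r \<cdot> t' \<cdot> y = fst r \<cdot> t"
    using A y(1) by (simp add: comp_assoc)
  ultimately have "is_span_mor C y q q'"
    using A by (auto simp: is_span_mor_def Hom_def q q')
  with pullback_sym[OF y(2)] that show thesis by blast
qed

text \<open>Whiskering a span morphism on either side pulls it back, so every pullback-stable class of
  morphisms that contains the isomorphisms induces a compatible relation.\<close>

lemma compatible_span_mor:
  assumes iso: "\<And>x. is_iso C x \<Longrightarrow> x \<in> W"
    and stable: "\<And>k w x h. \<lbrakk>w \<in> W; is_pullback C k w x h\<rbrakk> \<Longrightarrow> x \<in> W"
  shows "compatible C S {(p, q). p \<in> spans C S \<and> q \<in> spans C S \<and> (\<exists>x \<in> W. is_span_mor C x p q)}"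
    (is "compatible C S ?R")
proof (rule compatibleI)
  fix p q assume "(p, q) \<in> ?R"
  then show "p \<in> spans C S \<and> q \<in> spans C S \<and>
      Cod C (fst p) = Cod C (fst q) \<and> Cod C (snd p) = Cod C (snd q)"
    using span_mor_parallel by blast
next
  show "span_iso C S \<subseteq> ?R"
    using iso by (auto simp: span_iso_def)
next
  fix p q r p' q'
  assume pq: "(p, q) \<in> ?R" and r: "r \<in> spans C S"
    and c: "is_span_comp C r p p'" "is_span_comp C r q q'"
  obtain x where x: "x \<in> W" "is_span_mor C x p q" and s: "p \<in> spans C S" "q \<in> spans C S"
    using pq by blast
  obtain y k h where "is_span_mor C y p' q'" "is_pullback C k x y h"
    by (rule span_comp_mor_right[OF x(2) s r c])
  then show "(p', q') \<in> ?R"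
    using stable[OF x(1)] span_comp_spans(1)[OF _ r] s c by blast
next
  fix p q r p' q'
  assume pq: "(p, q) \<in> ?R" and r: "r \<in> spans C S"
    and c: "is_span_comp C p r p'" "is_span_comp C q r q'"
  obtain x where x: "x \<in> W" "is_span_mor C x p q" and s: "p \<in> spans C S" "q \<in> spans C S"
    using pq by blast
  obtain y k h where "is_span_mor C y p' q'" "is_pullback C k x y h"
    by (rule span_comp_mor_left[OF x(2) s r c])
  then show "(p', q') \<in> ?R"
    using stable[OF x(1)] span_comp_spans(1)[OF r] s c by blast
qed

lemma compatible_span_iso: "compatible C S (span_iso C S)"
proof -
  have "span_iso C S = {(p, q). p \<in> spans C S \<and> q \<in> spans C S \<and>
      (\<exists>x \<in> Collect (is_iso C). is_span_mor C x p q)}"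
    by (auto simp: span_iso_def)
  then show ?thesis
    using compatible_span_mor[of "Collect (is_iso C)"] pullback_of_iso by auto
qed

text \<open>The coarsest compatible relation. It inhabits the family whose intersection is
  \<open>approx_a C S\<close>.\<close>

lemma compatible_parallel:
  "compatible C S {(p, q). p \<in> spans C S \<and> q \<in> spans C S \<and>
     Cod C (fst p) = Cod C (fst q) \<and> Cod C (snd p) = Cod C (snd q)}"
    (is "compatible C S ?R")
proof (rule compatibleI)
  show "span_iso C S \<subseteq> ?R"
    using compatibleD(1-4)[OF compatible_span_iso] by blast
next
  fix p q r p' q'
  assume "(p, q) \<in> ?R" and r: "r \<in> spans C S"
    and c: "is_span_comp C r p p'" "is_span_comp C r q q'"
  then show "(p', q') \<in> ?R"
    using span_comp_spans(1-3)[OF _ r c(1)] span_comp_spans(1-3)[OF _ r c(2)] by simp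
next
  fix p q r p' q'
  assume "(p, q) \<in> ?R" and r: "r \<in> spans C S"
    and c: "is_span_comp C p r p'" "is_span_comp C q r q'"
  then show "(p', q') \<in> ?R"
    using span_comp_spans(1-3)[OF r _ c(1)] span_comp_spans(1-3)[OF r _ c(2)] by simp
qed blast

text \<open>The two factors are changed one at a time, through a composite \<open>u\<close> of
  \<open>q\<close> with \<open>p'\<close>, which exists because related spans are parallel.\<close>

lemma compatible_comp:
  assumes E: "compatible C S E" "equiv (spans C S) E"
    and pq: "(p, p') \<in> E" "(q, q') \<in> E"
    and c: "is_span_comp C q p r" "is_span_comp C q' p' r'"
  shows "(r, r') \<in> E"
proof -
  note P = compatibleD(1-4)[OF E(1) pq(1)] and Q = compatibleD(1-4)[OF E(1) pq(2)]
  have "Cod C (snd p') = Cod C (fst q)"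
    using P Q span_comp_spans(4)[OF P(1) Q(1) c(1)] by simp
  then obtain u where u: "is_span_comp C q p' u"
    using span_comp_exists P(2) Q(1) by blast
  have "(r, u) \<in> E"
    using compatibleD(6)[OF E(1) pq(1) Q(1) c(1) u] .
  moreover have "(u, r') \<in> E"
    using compatibleD(7)[OF E(1) pq(2) P(2) u c(2)] .
  ultimately show ?thesis
    using E(2) by (meson equivE transD)
qed

text \<open>The apex of the given composite \<open>a\<close> is itself the apex of a suitable
  pullback for the other bracketing, so associativity holds for these choices without a comparison
  isomorphism.\<close>

lemma span_comp_assoc:
  assumes s: "p \<in> spans C S" "q \<in> spans C S" "r \<in> spans C S"
    and c: "is_span_comp C q p u" "is_span_comp C r u a" "is_span_comp C r q v"
  shows "is_span_comp C v p a"
proof -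
  obtain t f where pb1: "is_pullback C (snd p) (fst q) t f" and u: "u = (fst p \<cdot> t, snd q \<cdot> f)"
    using c(1) by (auto simp: is_span_comp_def)
  obtain w g where pb2: "is_pullback C (snd q) (fst r) w g" and v: "v = (fst q \<cdot> w, snd r \<cdot> g)"
    using c(3) by (auto simp: is_span_comp_def)
  obtain w' g' where pb3: "is_pullback C (snd q \<cdot> f) (fst r) w' g'"
    and a: "a = (fst p \<cdot> t \<cdot> w', snd r \<cdot> g')"
    using c(2) u by (auto simp: is_span_comp_def)
  note A = spansD[OF s(1)] spansD[OF s(2)] spansD[OF s(3)]
    pullback_arr[OF pb1] pullback_arr[OF pb2] pullback_arr[OF pb3]
  \<comment> \<open>The square \<open>pb3\<close> splits into \<open>pb2\<close> and a new square
    over \<open>f\<close>; gluing the latter to \<open>pb1\<close> gives the pullback for the other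
    bracketing.\<close>
  obtain b where b: "g \<cdot> b = g'" "is_pullback C f w w' b"
    using pullback_unpaste[OF pb2 pb3] A by auto
  note A = A pullback_arr[OF b(2)]
  have "is_pullback C (fst q \<cdot> w) (snd p) b (t \<cdot> w')"
    using pullback_paste[OF pullback_sym[OF pb1] pullback_sym[OF b(2)]] .
  then have "is_pullback C (snd p) (fst v) (t \<cdot> w') b"
    unfolding v fst_conv by (rule pullback_sym)
  moreover have "a = (fst p \<cdot> (t \<cdot> w'), snd v \<cdot> b)"
    using A b(1) by (simp add: a v comp_assoc)
  ultimately show ?thesis
    unfolding is_span_comp_def by blast
qed

lemma span_comp_ident_right:
  assumes "p \<in> spans C S" "A = Cod C (fst p)"
  shows "is_span_comp C p (Ident C A, Ident C A) p"
  using pullback_sym[OF pullback_ident, of "fst p"] spansD[OF assms(1)] assms(2)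
  unfolding is_span_comp_def
  by (intro exI[of _ "fst p"] exI[of _ "Ident C (Dom C (fst p))"]) auto

lemma span_comp_ident_left:
  assumes "p \<in> spans C S" "A = Cod C (snd p)"
  shows "is_span_comp C (Ident C A, Ident C A) p p"
  using pullback_ident[of "snd p"] spansD[OF assms(1)] assms(2)
  unfolding is_span_comp_def
  by (intro exI[of _ "Ident C (Dom C (fst p))"] exI[of _ "snd p"]) auto


section \<open>The category of spans\<close>

definition span_class :: "'a \<times> 'a \<Rightarrow> ('a \<times> 'a) set" where
  "span_class p = span_iso C S `` {p}"

lemma span_class_eq:
  "\<lbrakk>p \<in> spans C S; q \<in> spans C S\<rbrakk> \<Longrightarrow> span_class p = span_class q \<longleftrightarrow> (p, q) \<in> span_iso C S"
  unfolding span_class_def by (rule eq_equiv_class_iff[OF equiv_span_iso])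

lemma span_class_arr: "p \<in> spans C S \<Longrightarrow> span_class p \<in> Arr (span_cat C S)"
  by (auto simp: span_cat_def span_class_def quotient_def)

lemma span_cat_arrE:
  assumes "X \<in> Arr (span_cat C S)"
  obtains p where "p \<in> spans C S" "X = span_class p"
  using assms by (auto simp: span_cat_def span_class_def quotient_def)

lemma span_cat_obj: "Obj (span_cat C S) = Obj C"
  and span_cat_ident: "Ident (span_cat C S) A = span_class (Ident C A, Ident C A)"
  by (simp_all add: span_cat_def span_class_def)

lemma span_cat_dom:
  assumes "p \<in> spans C S"
  shows "Dom (span_cat C S) (span_class p) = Cod C (fst p)"
  using the_elem_image_class[OF equiv_span_iso assms, of "\<lambda>p. Cod C (fst p)"]
    compatibleD(3)[OF compatible_span_iso, of p]
  by (simp add: span_cat_def span_class_def)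

lemma span_cat_cod:
  assumes "p \<in> spans C S"
  shows "Cod (span_cat C S) (span_class p) = Cod C (snd p)"
  using the_elem_image_class[OF equiv_span_iso assms, of "\<lambda>p. Cod C (snd p)"]
    compatibleD(4)[OF compatible_span_iso, of p]
  by (simp add: span_cat_def span_class_def)

lemma span_cat_comp:
  assumes p: "p \<in> spans C S" and q: "q \<in> spans C S" and r: "is_span_comp C q p r"
  shows "span_class q \<cdot>\<^bsub>span_cat C S\<^esub> span_class p = span_class r"
proof -
  have "span_iso C S `` {r'. is_span_comp C q' p' r'} = span_class r"
    if q': "(q, q') \<in> span_iso C S" and p': "(p, p') \<in> span_iso C S" for q' p'
  proof -
    have iso: "(r, r') \<in> span_iso C S" if "is_span_comp C q' p' r'" for r'
      using compatible_comp[OF compatible_span_iso equiv_span_iso p' q' r that] .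
    note P = compatibleD(1-4)[OF compatible_span_iso p']
      and Q = compatibleD(1-4)[OF compatible_span_iso q']
    \<comment> \<open>Every pair of representatives needs a composite of its own; otherwise its
      contribution to the union would be empty instead of \<open>span_class r\<close>.\<close>
    have "Cod C (snd p') = Cod C (fst q')"
      using P Q span_comp_spans(4)[OF p q r] by simp
    then obtain r' where r': "is_span_comp C q' p' r'"
      using span_comp_exists P(2) Q(2) by blast
    have "span_iso C S `` {r''} = span_iso C S `` {r}" if "is_span_comp C q' p' r''" for r''
      using equiv_class_eq[OF equiv_span_iso iso[OF that]] by simp
    then show ?thesis
      unfolding span_class_def using r' by blast
  qed
  then have "span_class q \<cdot>\<^bsub>span_cat C S\<^esub> span_class p
      = (\<Union>q' \<in> span_class q. \<Union>p' \<in> span_class p. span_class r)"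
    by (simp add: span_cat_def span_class_def)
  moreover have "span_class q \<noteq> {}" "span_class p \<noteq> {}"
    using equiv_class_self[OF equiv_span_iso] p q unfolding span_class_def by blast+
  ultimately show ?thesis by simp
qed

lemmas span_cat_simps =
  span_class_arr span_cat_obj span_cat_ident span_cat_dom span_cat_cod span_cat_comp

lemma category_span_cat: "category (span_cat C S)"
proof
  fix X assume "X \<in> Arr (span_cat C S)"
  then obtain p where p: "p \<in> spans C S" "X = span_class p" by (rule span_cat_arrE)
  have obj: "Cod C (fst p) \<in> Obj C" "Cod C (snd p) \<in> Obj C"
    using spansD[OF p(1)] by simp_all
  show "Dom (span_cat C S) X \<in> Obj (span_cat C S)" "Cod (span_cat C S) X \<in> Obj (span_cat C S)"
    using p obj by (simp_all add: span_cat_simps)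
  show "X \<cdot>\<^bsub>span_cat C S\<^esub> Ident (span_cat C S) (Dom (span_cat C S) X) = X"
    using p span_cat_comp[OF ident_span p(1) span_comp_ident_right] obj by (simp add: span_cat_simps)
  show "Ident (span_cat C S) (Cod (span_cat C S) X) \<cdot>\<^bsub>span_cat C S\<^esub> X = X"
    using p span_cat_comp[OF p(1) ident_span span_comp_ident_left] obj by (simp add: span_cat_simps)
next
  fix A assume "A \<in> Obj (span_cat C S)"
  then show "Ident (span_cat C S) A \<in> Hom (span_cat C S) A A"
    using ident_span[of A] by (simp add: span_cat_simps Hom_def)
next
  fix X Y
  assume X: "X \<in> Arr (span_cat C S)" and Y: "Y \<in> Arr (span_cat C S)"
    and c: "Cod (span_cat C S) X = Dom (span_cat C S) Y"
  obtain p where p: "p \<in> spans C S" "X = span_class p" using X by (rule span_cat_arrE)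
  obtain q where q: "q \<in> spans C S" "Y = span_class q" using Y by (rule span_cat_arrE)
  obtain r where r: "is_span_comp C q p r"
    using span_comp_exists[OF p(1) q(1)] c p q by (auto simp: span_cat_simps)
  show "Y \<cdot>\<^bsub>span_cat C S\<^esub> X \<in> Hom (span_cat C S) (Dom (span_cat C S) X) (Cod (span_cat C S) Y)"
    using span_comp_spans[OF p(1) q(1) r] p q r by (simp add: span_cat_simps Hom_def)
next
  fix X Y Z
  assume X: "X \<in> Arr (span_cat C S)" and Y: "Y \<in> Arr (span_cat C S)"
    and Z: "Z \<in> Arr (span_cat C S)"
    and c: "Cod (span_cat C S) X = Dom (span_cat C S) Y" "Cod (span_cat C S) Y = Dom (span_cat C S) Z"
  obtain p where p: "p \<in> spans C S" "X = span_class p" using X by (rule span_cat_arrE)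
  obtain q where q: "q \<in> spans C S" "Y = span_class q" using Y by (rule span_cat_arrE)
  obtain r where r: "r \<in> spans C S" "Z = span_class r" using Z by (rule span_cat_arrE)
  obtain u where u: "is_span_comp C q p u"
    using span_comp_exists[OF p(1) q(1)] c p q by (auto simp: span_cat_simps)
  obtain v where v: "is_span_comp C r q v"
    using span_comp_exists[OF q(1) r(1)] c q r by (auto simp: span_cat_simps)
  note U = span_comp_spans[OF p(1) q(1) u] and V = span_comp_spans[OF q(1) r(1) v]
  obtain a where a: "is_span_comp C r u a"
    using span_comp_exists[OF U(1) r(1)] U V by auto
  have "Z \<cdot>\<^bsub>span_cat C S\<^esub> Y \<cdot>\<^bsub>span_cat C S\<^esub> X = span_class a"
    using span_cat_comp[OF p(1) V(1) span_comp_assoc[OF p(1) q(1) r(1) u a v]]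
      span_cat_comp[OF q(1) r(1) v] p q r by simp
  also have "\<dots> = Z \<cdot>\<^bsub>span_cat C S\<^esub> (Y \<cdot>\<^bsub>span_cat C S\<^esub> X)"
    using span_cat_comp[OF U(1) r(1) a] span_cat_comp[OF p(1) q(1) u] p q r by simp
  finally show "Z \<cdot>\<^bsub>span_cat C S\<^esub> Y \<cdot>\<^bsub>span_cat C S\<^esub> X
      = Z \<cdot>\<^bsub>span_cat C S\<^esub> (Y \<cdot>\<^bsub>span_cat C S\<^esub> X)" .
qed


section \<open>Compatible equivalence relations on spans\<close>

text \<open>Zigzags are never unfolded: \<open>F\<close> collects the pairs of \<open>?E\<close>
  whose whiskerings stay in \<open>?E\<close>. It is an equivalence relation containing
  \<open>R\<close>, so minimality of \<open>?E\<close> gives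
  \<open>?E \<subseteq> F\<close>.\<close>

lemma compatible_generated_equiv:
  assumes R: "compatible C S R"
  shows "compatible C S (generated_equiv (spans C S) R)"
proof -
  let ?E = "generated_equiv (spans C S) R"
  have eq: "equiv (spans C S) ?E"
    by (rule equiv_generated_equiv) (use compatibleD(1,2)[OF R] in auto)
  have E_spans: "p \<in> spans C S" "q \<in> spans C S" if "(p, q) \<in> ?E" for p q
    using that eq by (auto simp: equiv_def)
  have E_refl: "(p, p) \<in> ?E" if "p \<in> spans C S" for p
    using that eq by (auto simp: equiv_def refl_on_def)
  have E_sym: "(q, p) \<in> ?E" if "(p, q) \<in> ?E" for p q
    using that eq by (meson equivE symD)
  have E_trans: "(p, r) \<in> ?E" if "(p, q) \<in> ?E" "(q, r) \<in> ?E" for p q r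
    using that eq by (meson equivE transD)
  have iso: "span_iso C S \<subseteq> ?E"
    using compatibleD(5)[OF R] generated_equiv_upper by blast
  \<comment> \<open>Related spans are parallel, again by minimality; transitivity of
    \<open>F\<close> relies on this to whisker the middle span.\<close>
  have "?E \<subseteq> {(p, q). p \<in> spans C S \<and> q \<in> spans C S \<and>
      Cod C (fst p) = Cod C (fst q) \<and> Cod C (snd p) = Cod C (snd q)}" (is "_ \<subseteq> ?P")
  proof (rule generated_equiv_least)
    show "equiv (spans C S) ?P"
      by (rule equivI) (auto simp: refl_on_def sym_def trans_def)
    show "R \<subseteq> ?P"
      using compatibleD(1-4)[OF R] by blast
  qed
  then have ends: "Cod C (fst p) = Cod C (fst q)" "Cod C (snd p) = Cod C (snd q)"
    if "(p, q) \<in> ?E" for p q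
    using that by blast+
  define F where "F = {(p, q). (p, q) \<in> ?E \<and> (\<forall>r \<in> spans C S. \<forall>p' q'.
    is_span_comp C r p p' \<and> is_span_comp C r q q' \<or> is_span_comp C p r p' \<and> is_span_comp C q r q'
      \<longrightarrow> (p', q') \<in> ?E)}"
  have F_E: "(p, q) \<in> ?E" if "(p, q) \<in> F" for p q
    using that unfolding F_def by blast
  have F_right: "(p', q') \<in> ?E"
    if "(p, q) \<in> F" "r \<in> spans C S" "is_span_comp C r p p'" "is_span_comp C r q q'" for p q r p' q'
    using that unfolding F_def by blast
  have F_left: "(p', q') \<in> ?E"
    if "(p, q) \<in> F" "r \<in> spans C S" "is_span_comp C p r p'" "is_span_comp C q r q'" for p q r p' q'
    using that unfolding F_def by blast
  have FI: "(p, q) \<in> F"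
    if "(p, q) \<in> ?E"
      "\<And>r p' q'. \<lbrakk>r \<in> spans C S; is_span_comp C r p p'; is_span_comp C r q q'\<rbrakk> \<Longrightarrow> (p', q') \<in> ?E"
      "\<And>r p' q'. \<lbrakk>r \<in> spans C S; is_span_comp C p r p'; is_span_comp C q r q'\<rbrakk> \<Longrightarrow> (p', q') \<in> ?E"
    for p q
    using that unfolding F_def by blast
  have "equiv (spans C S) F"
  proof (rule equivI)
    show "F \<subseteq> spans C S \<times> spans C S"
      by (rule subrelI) (blast intro: E_spans F_E)
    show "refl_on (spans C S) F"
    proof (rule refl_onI)
      fix p assume p: "p \<in> spans C S"
      \<comment> \<open>Two composites of the same pair of spans are only isomorphic, so reflexivity
        of \<open>F\<close> rests on compatibility of \<open>span_iso\<close>.\<close>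
      then have "(p, p) \<in> span_iso C S"
        using equiv_span_iso by (auto simp: equiv_def refl_on_def)
      then show "(p, p) \<in> F"
        using p iso E_refl compatibleD(6,7)[OF compatible_span_iso, of p p] by (intro FI) blast+
    qed
    show "sym F"
      using F_E F_right F_left E_sym by (intro symI FI) blast+
    show "trans F"
    proof (rule transI)
      fix p q s assume pq: "(p, q) \<in> F" and qs: "(q, s) \<in> F"
      note E = F_E[OF pq] F_E[OF qs]
      note s = E_spans[OF E(1)]
      show "(p, s) \<in> F"
      proof (rule FI)
        show "(p, s) \<in> ?E"
          by (rule E_trans[OF E])
      next
        fix r p' s' assume r: "r \<in> spans C S" and c: "is_span_comp C r p p'" "is_span_comp C r s s'"
        have "Cod C (snd q) = Cod C (fst r)"
          using span_comp_spans(4)[OF s(1) r c(1)] ends(2)[OF E(1)] by simp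
        then obtain q' where q': "is_span_comp C r q q'"
          by (rule span_comp_exists[OF s(2) r])
        show "(p', s') \<in> ?E"
          by (rule E_trans[OF F_right[OF pq r c(1) q'] F_right[OF qs r q' c(2)]])
      next
        fix r p' s' assume r: "r \<in> spans C S" and c: "is_span_comp C p r p'" "is_span_comp C s r s'"
        have "Cod C (snd r) = Cod C (fst q)"
          using span_comp_spans(4)[OF r s(1) c(1)] ends(1)[OF E(1)] by simp
        then obtain q' where q': "is_span_comp C q r q'"
          by (rule span_comp_exists[OF r s(2)])
        show "(p', s') \<in> ?E"
          by (rule E_trans[OF F_left[OF pq r c(1) q'] F_left[OF qs r q' c(2)]])
      qed
    qed
  qed
  moreover have "R \<subseteq> F"
  proof (rule subrelI)
    fix p q assume pq: "(p, q) \<in> R"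
    show "(p, q) \<in> F"
      using compatibleD(6,7)[OF R pq] pq generated_equiv_upper[of R "spans C S"]
      by (intro FI) blast+
  qed
  ultimately have F: "?E \<subseteq> F"
    by (rule generated_equiv_least)
  show ?thesis
    by (rule compatibleI) (use E_spans ends iso F F_right F_left in blast)+
qed

lemma on_classesE:
  assumes "(X, Y) \<in> on_classes C S E"
  obtains p q where "(p, q) \<in> E" "X = span_class p" "Y = span_class q"
  using assms by (auto simp: on_classes_def span_class_def)

context
  fixes E
  assumes comp: "compatible C S E" and eq: "equiv (spans C S) E"
begin

text \<open>Since \<open>E\<close> contains \<open>span_iso\<close>, it is saturated under
  isomorphism of spans, so passing to classes loses no information.\<close>

lemma on_classes_iff:
  assumes pq: "p \<in> spans C S" "q \<in> spans C S"
  shows "(span_class p, span_class q) \<in> on_classes C S E \<longleftrightarrow> (p, q) \<in> E"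
proof
  assume "(span_class p, span_class q) \<in> on_classes C S E"
  then obtain p' q' where E: "(p', q') \<in> E"
    and c: "span_class p = span_class p'" "span_class q = span_class q'"
    by (rule on_classesE)
  have "(p, p') \<in> E" "(q, q') \<in> E"
    using c span_class_eq[OF pq(1) compatibleD(1)[OF comp E]]
      span_class_eq[OF pq(2) compatibleD(2)[OF comp E]] compatibleD(5)[OF comp] by auto
  with E eq show "(p, q) \<in> E"
    by (meson equivE symD transD)
next
  assume "(p, q) \<in> E"
  then show "(span_class p, span_class q) \<in> on_classes C S E"
    unfolding on_classes_def span_class_def by blast
qed

lemma congruence_on_classes: "congruence (span_cat C S) (on_classes C S E)"
proof -
  let ?R = "on_classes C S E"
  have E: "sym E" "trans E" "\<And>p. p \<in> spans C S \<Longrightarrow> (p, p) \<in> E"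
    using eq by (auto simp: equiv_def refl_on_def)
  note ED = compatibleD(1-4)[OF comp]
  have "equiv (Arr (span_cat C S)) ?R"
  proof (rule equivI)
    show "?R \<subseteq> Arr (span_cat C S) \<times> Arr (span_cat C S)"
      using ED(1,2) by (auto elim!: on_classesE intro!: span_class_arr)
    show "refl_on (Arr (span_cat C S)) ?R"
      by (rule refl_onI) (auto elim!: span_cat_arrE simp: on_classes_iff E(3))
    show "sym ?R"
      using E(1) unfolding on_classes_def by (fastforce intro!: symI dest: symD)
    show "trans ?R"
    proof (rule transI)
      fix X Y Z assume XY: "(X, Y) \<in> ?R" and YZ: "(Y, Z) \<in> ?R"
      obtain p q where pq: "(p, q) \<in> E" "X = span_class p" "Y = span_class q"
        using XY by (rule on_classesE)
      obtain q' r where qr: "(q', r) \<in> E" "Y = span_class q'" "Z = span_class r"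
        using YZ by (rule on_classesE)
      \<comment> \<open>The middle class is presented by two spans \<open>q\<close> and
        \<open>q'\<close> that may differ; \<open>on_classes_iff\<close> moves the second relation
        to \<open>q\<close>.\<close>
      have "(q, r) \<in> E"
        using YZ on_classes_iff[OF ED(2)[OF pq(1)] ED(2)[OF qr(1)]] pq(3) qr(3) by simp
      then have "(p, r) \<in> E"
        using transD[OF E(2) pq(1)] by simp
      then show "(X, Z) \<in> ?R"
        using on_classes_iff ED pq(2) qr(3) by simp
    qed
  qed
  moreover have "Dom (span_cat C S) X = Dom (span_cat C S) Y \<and> Cod (span_cat C S) X = Cod (span_cat C S) Y"
    if XY: "(X, Y) \<in> ?R" for X Y
  proof -
    obtain p q where pq: "(p, q) \<in> E" "X = span_class p" "Y = span_class q"
      using XY by (rule on_classesE)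
    then show ?thesis
      using ED[OF pq(1)] by (simp add: span_cat_simps)
  qed
  moreover have "(Y \<cdot>\<^bsub>span_cat C S\<^esub> X, Y' \<cdot>\<^bsub>span_cat C S\<^esub> X') \<in> ?R"
    if X: "(X, X') \<in> ?R" and Y: "(Y, Y') \<in> ?R" and c: "Cod (span_cat C S) X = Dom (span_cat C S) Y"
    for X X' Y Y'
  proof -
    obtain p p' where p: "(p, p') \<in> E" "X = span_class p" "X' = span_class p'"
      using X by (rule on_classesE)
    obtain q q' where q: "(q, q') \<in> E" "Y = span_class q" "Y' = span_class q'"
      using Y by (rule on_classesE)
    note P = ED[OF p(1)] and Q = ED[OF q(1)]
    have ends: "Cod C (snd p) = Cod C (fst q)"
      using c p q P Q by (simp add: span_cat_simps)
    obtain r where r: "is_span_comp C q p r"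
      using span_comp_exists[OF P(1) Q(1) ends] .
    obtain r' where r': "is_span_comp C q' p' r'"
      using span_comp_exists[OF P(2) Q(2)] ends P Q by auto
    have "(r, r') \<in> E"
      using compatible_comp[OF comp eq p(1) q(1) r r'] .
    then have "(span_class r, span_class r') \<in> ?R"
      using on_classes_iff ED by blast
    then show ?thesis
      using span_cat_comp[OF P(1) Q(1) r] span_cat_comp[OF P(2) Q(2) r'] p q by simp
  qed
  ultimately show ?thesis
    unfolding congruence_def by blast
qed

end

text \<open>Isomorphic spans are already identified in \<open>span_cat\<close>. In the monic case
  this makes Sect a quotient by equality.\<close>

lemma on_classes_span_iso: "on_classes C S (span_iso C S) = Id_on (Arr (span_cat C S))"
proof -
  have "(X, Y) \<in> on_classes C S (span_iso C S) \<longleftrightarrow> (X, Y) \<in> Id_on (Arr (span_cat C S))" for X Y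
  proof
    assume "(X, Y) \<in> on_classes C S (span_iso C S)"
    then obtain p q where pq: "(p, q) \<in> span_iso C S" "X = span_class p" "Y = span_class q"
      by (rule on_classesE)
    note s = compatibleD(1,2)[OF compatible_span_iso pq(1)]
    show "(X, Y) \<in> Id_on (Arr (span_cat C S))"
      using pq span_class_eq[OF s] span_class_arr[OF s(1)] by auto
  next
    assume "(X, Y) \<in> Id_on (Arr (span_cat C S))"
    then have "X = Y" "X \<in> Arr (span_cat C S)"
      by auto
    then show "(X, Y) \<in> on_classes C S (span_iso C S)"
      using congruenceD(7)[OF congruence_on_classes[OF compatible_span_iso equiv_span_iso]] by simp
  qed
  then show ?thesis by auto
qed


section \<open>Conjugates\<close>

text \<open>The identity on the codomain of \<open>x\<close> is its own conjugate as an endomorphism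
  of the identity cospan there, and an isomorphism is a pullback of an identity.\<close>

lemma S_star_iso:
  assumes x: "is_iso C x"
  shows "x \<in> S_star C S"
proof -
  define I where "I = Ident C (Cod C x)"
  have A: "x \<in> Arr C" "Cod C x \<in> Obj C"
    using x by (auto simp: is_iso_def)
  have I: "I \<in> Arr C" "Dom C I = Cod C x" "Cod C I = Cod C x" "I \<cdot> I = I" "I \<in> S"
    using A ident_S by (auto simp: I_def)
  have pb: "is_pullback C I I I I"
    using pullback_ident[OF I(1)] I by (simp add: I_def)
  have "is_conjugate C (I, I) (I, I) I I"
    unfolding is_conjugate_def is_cospan_mor_def is_span_mor_def is_pb_def
    using I pb by (auto simp: Hom_def intro!: exI[of _ I])
  moreover have "is_pullback C I I x x"
    using pullback_transport[OF pb x] A I by (simp add: I_def)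
  moreover have "(I, I) \<in> cospans C S"
    using I by (simp add: cospans_def)
  ultimately show ?thesis
    unfolding S_star_def using I(5) by blast
qed

lemma S_star_pullback:
  assumes "w \<in> S_star C S" "is_pullback C k w x h"
  shows "x \<in> S_star C S"
proof -
  obtain c d v w' k' h' where "c \<in> cospans C S" "d \<in> cospans C S" "v \<in> S"
    "is_conjugate C c d v w'" and pb: "is_pullback C k' w' w h'"
    using assms(1) unfolding S_star_def by blast
  with pullback_paste[OF pb assms(2)] show ?thesis
    unfolding S_star_def by blast
qed

text \<open>Every arrow is a pullback of itself along an identity.\<close>

lemma conjugate_S_star:
  assumes "c \<in> cospans C S" "d \<in> cospans C S" "v \<in> S" "is_conjugate C c d v w"
  shows "w \<in> S_star C S"
proof -
  have "w \<in> Arr C"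
    using assms(4) by (auto simp: is_conjugate_def is_span_mor_def Hom_def)
  from pullback_sym[OF pullback_ident[OF this]] assms show ?thesis
    unfolding S_star_def by blast
qed

text \<open>Composing the commuting square of \<open>p\<close> with \<open>v\<close> makes
  \<open>p\<close> a cone over \<open>d\<close>, which lifts through \<open>q\<close>. The pullbacks
  are prescribed in advance because \<open>approx_a\<close> quantifies over all choices of
  them.\<close>

lemma conjugate_exists:
  assumes v: "is_cospan_mor C v c d" and pb: "is_pb C c p" "is_pb C d q"
  obtains w where "is_span_mor C w p q" "is_conjugate C c d v w"
proof -
  note P = pb(1)[unfolded is_pb_def] and Q = pb(2)[unfolded is_pb_def]
  have V: "v \<in> Arr C" "Dom C v = Cod C (fst c)" "v \<cdot> fst c = fst d" "v \<cdot> snd c = snd d"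
    using v by (auto simp: is_cospan_mor_def Hom_def)
  note A = V(1,2) pullback_arr(1-8)[OF P] pullback_arr(1-8)[OF Q]
  have "fst d \<cdot> fst p = v \<cdot> (fst c \<cdot> fst p)"
    unfolding V(3)[symmetric] by (rule comp_assoc) (use A in simp_all)
  also have "\<dots> = v \<cdot> (snd c \<cdot> snd p)"
    using pullback_arr(9)[OF P] by simp
  also have "\<dots> = snd d \<cdot> snd p"
    unfolding V(4)[symmetric] by (rule comp_assoc[symmetric]) (use A in simp_all)
  finally have sq: "fst d \<cdot> fst p = snd d \<cdot> snd p" .
  have "Dom C (fst d) = Dom C (fst c)" "Dom C (snd d) = Dom C (snd c)"
    unfolding V(3,4)[symmetric] using A by simp_all
  then obtain w where "w \<in> Arr C" "Dom C w = Dom C (fst p)" "Cod C w = Dom C (fst q)"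
      "fst q \<cdot> w = fst p" "snd q \<cdot> w = snd p"
    using pullback_lift[OF Q, of "fst p" "snd p"] sq A by auto
  then have "is_span_mor C w p q"
    by (simp add: is_span_mor_def Hom_def)
  with v pb that show thesis
    unfolding is_conjugate_def by blast
qed

section \<open>Compatibility and comparison of the two relations\<close>

lemma pb_spans:
  assumes "c \<in> cospans C S" "is_pb C c p"
  shows "p \<in> spans C S" "Cod C (fst p) = Dom C (fst c)" "Cod C (snd p) = Dom C (snd c)"
proof -
  note pb = assms(2)[unfolded is_pb_def]
  have "snd c \<in> S"
    using assms(1) by (auto simp: cospans_def)
  then show "p \<in> spans C S" "Cod C (fst p) = Dom C (fst c)" "Cod C (snd p) = Dom C (snd c)"
    using S_pullback[OF _ pb] pullback_arr[OF pb] by (auto simp: spans_def case_prod_beta)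
qed

text \<open>It remains to exhibit one relation in the intersected family. Parallelism qualifies:
  \<open>v\<close> leaves the domains of the cospan legs unchanged, and these are the ends of the
  pullback spans.\<close>

lemma compatible_approx_a: "compatible C S (approx_a C S)"
  unfolding approx_a_def
proof (rule compatible_Inter)
  let ?P = "{(p, q). p \<in> spans C S \<and> q \<in> spans C S \<and>
     Cod C (fst p) = Cod C (fst q) \<and> Cod C (snd p) = Cod C (snd q)}"
  have "(p, q) \<in> ?P"
    if cd: "c \<in> cospans C S" "d \<in> cospans C S"
      and le: "cospan_le C S c d" and pb: "is_pb C c p" "is_pb C d q" for c d p q
  proof -
    obtain v where v: "v \<in> Arr C" "Dom C v = Cod C (fst c)" "v \<cdot> fst c = fst d" "v \<cdot> snd c = snd d"
      using le by (auto simp: cospan_le_def is_cospan_mor_def Hom_def)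
    have "fst c \<in> Arr C" "snd c \<in> Arr C" "Cod C (snd c) = Cod C (fst c)"
      using cd(1) S_arr by (auto simp: cospans_def)
    then have "Dom C (fst d) = Dom C (fst c)" "Dom C (snd d) = Dom C (snd c)"
      unfolding v(3,4)[symmetric] using v(1,2) by simp_all
    then show ?thesis
      using pb_spans[OF cd(1) pb(1)] pb_spans[OF cd(2) pb(2)] by simp
  qed
  then have "?P \<in> {R. compatible C S R \<and>
     (\<forall>c \<in> cospans C S. \<forall>d \<in> cospans C S. \<forall>p q.
        cospan_le C S c d \<and> is_pb C c p \<and> is_pb C d q \<longrightarrow> (p, q) \<in> R)}"
    using compatible_parallel by blast
  then show "{R. compatible C S R \<and>
     (\<forall>c \<in> cospans C S. \<forall>d \<in> cospans C S. \<forall>p q.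
        cospan_le C S c d \<and> is_pb C c p \<and> is_pb C d q \<longrightarrow> (p, q) \<in> R)} \<noteq> {}"
    by blast
qed blast

lemma compatible_sim_a: "compatible C S (sim_a C S)"
  unfolding sim_a_def by (rule compatible_generated_equiv[OF compatible_approx_a])

lemma equiv_sim_a: "equiv (spans C S) (sim_a C S)"
  unfolding sim_a_def
  by (rule equiv_generated_equiv) (use compatibleD(1,2)[OF compatible_approx_a] in auto)

lemma compatible_sim_zstar: "compatible C S (sim_zstar C S)"
  unfolding sim_zstar_def
  by (rule compatible_generated_equiv[OF compatible_span_mor[OF S_star_iso S_star_pullback]])

lemma equiv_sim_zstar: "equiv (spans C S) (sim_zstar C S)"
  unfolding sim_zstar_def by (rule equiv_generated_equiv) auto

text \<open>Two minimality arguments in a row: \<open>sim_zstar C S\<close> is compatible and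
  contains the generating pairs, hence contains \<open>approx_a C S\<close>; being an equivalence
  relation, it contains the closure as well.\<close>

lemma sim_a_subset_sim_zstar: "sim_a C S \<subseteq> sim_zstar C S"
proof -
  have "(p, q) \<in> sim_zstar C S"
    if cd: "c \<in> cospans C S" "d \<in> cospans C S"
      and le: "cospan_le C S c d" and pb: "is_pb C c p" "is_pb C d q" for c d p q
  proof -
    obtain v where v: "v \<in> S" "is_cospan_mor C v c d"
      using le by (auto simp: cospan_le_def)
    obtain w where w: "is_span_mor C w p q" "is_conjugate C c d v w"
      by (rule conjugate_exists[OF v(2) pb])
    then have "w \<in> S_star C S"
      using conjugate_S_star[OF cd v(1)] by blast
    then show ?thesis
      using w(1) pb_spans(1)[OF cd(1) pb(1)] pb_spans(1)[OF cd(2) pb(2)]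
      unfolding sim_zstar_def by (intro subsetD[OF generated_equiv_upper]) blast
  qed
  then have "approx_a C S \<subseteq> sim_zstar C S"
    using compatible_sim_zstar unfolding approx_a_def by (intro Inter_lower) blast
  then show ?thesis
    unfolding sim_a_def using equiv_sim_zstar by (intro generated_equiv_least)
qed

section \<open>The case of monomorphisms\<close>

lemma pullback_of_mono_comp:
  assumes pb: "is_pullback C (v \<cdot> f) (v \<cdot> g) p q" and v: "is_mono C v"
    and fg: "f \<in> Arr C" "g \<in> Arr C" "Cod C f = Dom C v" "Cod C g = Dom C v"
  shows "is_pullback C f g p q"
proof -
  have mono: "a = b" if "a \<in> Arr C" "b \<in> Arr C" "Dom C a = Dom C b" "Cod C a = Dom C v"
      "Cod C b = Dom C v" "v \<cdot> a = v \<cdot> b" for a b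
    using v that unfolding is_mono_def Hom_def by blast
  have "v \<in> Arr C"
    using v by (simp add: is_mono_def)
  note A = this fg pullback_arr[OF pb]
  show ?thesis
  proof (rule pullbackI)
    have "v \<cdot> (f \<cdot> p) = v \<cdot> (g \<cdot> q)"
      using A by (simp add: comp_assoc)
    then show "f \<cdot> p = g \<cdot> q"
      by (rule mono[rotated 5]) (use A in simp_all)
  next
    fix a b
    assume ab: "a \<in> Arr C" "b \<in> Arr C" "Dom C a = Dom C b" "Cod C a = Dom C f"
      "Cod C b = Dom C g" "f \<cdot> a = g \<cdot> b"
    \<comment> \<open>A cone over \<open>f\<close> and \<open>g\<close> is one over their composites
      with \<open>v\<close>, so the given pullback supplies the lift; monicity of \<open>v\<close>
      enters in the commutativity of the square.\<close>
    have "v \<cdot> f \<cdot> a = v \<cdot> g \<cdot> b"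
      using A ab by (simp add: comp_assoc)
    then obtain u where "u \<in> Arr C" "Dom C u = Dom C a" "Cod C u = Dom C p" "p \<cdot> u = a" "q \<cdot> u = b"
      using pullback_lift[OF pb, of a b] A ab by auto
    then show "\<exists>u. u \<in> Arr C \<and> Dom C u = Dom C a \<and> Cod C u = Dom C p \<and> p \<cdot> u = a \<and> q \<cdot> u = b"
      by blast
  qed (use A pullback_cancel[OF pb] in simp_all)
qed

text \<open>Cancelling \<open>v\<close> makes \<open>p\<close> and \<open>q\<close> pullbacks of the
  same cospan \<open>c\<close>, so they differ by an isomorphism, and uniqueness of lifts identifies
  it with \<open>w\<close>.\<close>

lemma conjugate_of_mono_iso:
  assumes w: "is_conjugate C c d v w" and v: "is_mono C v"
  shows "is_iso C w"
proof -
  obtain p q where cm: "is_cospan_mor C v c d" and P: "is_pullback C (fst c) (snd c) (fst p) (snd p)"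
    and Q: "is_pullback C (fst d) (snd d) (fst q) (snd q)" and m: "is_span_mor C w p q"
    using w by (auto simp: is_conjugate_def is_pb_def)
  have "Cod C (fst c) = Dom C v" "fst d = v \<cdot> fst c" "snd d = v \<cdot> snd c"
    using cm by (auto simp: is_cospan_mor_def Hom_def)
  then have "is_pullback C (fst c) (snd c) (fst q) (snd q)"
    using pullback_of_mono_comp[OF _ v] Q pullback_arr[OF P] by simp
  then obtain x where x: "is_iso C x" "Dom C x = Dom C (fst p)" "Cod C x = Dom C (fst q)"
      "fst q \<cdot> x = fst p" "snd q \<cdot> x = snd p"
    by (rule pullback_unique[OF P])
  have "x \<in> Arr C"
    using x(1) by (simp add: is_iso_def)
  then have "w = x"
    using pullback_cancel[OF Q, of w x] span_morD[OF m] x by simp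
  with x(1) show ?thesis by simp
qed

text \<open>A sandwich: \<open>span_iso\<close> lies in \<open>sim_a\<close>, which lies in
  \<open>sim_zstar\<close>; the latter falls back into \<open>span_iso\<close> because pullbacks of
  isomorphisms are isomorphisms.\<close>

lemma sims_eq_span_iso_if_monos:
  assumes mono: "\<forall>s \<in> S. is_mono C s"
  shows "sim_a C S = span_iso C S" "sim_zstar C S = span_iso C S"
proof -
  have "is_iso C x" if "x \<in> S_star C S" for x
    using that conjugate_of_mono_iso pullback_of_iso mono unfolding S_star_def by blast
  then have "{(p, q). p \<in> spans C S \<and> q \<in> spans C S \<and> (\<exists>x \<in> S_star C S. is_span_mor C x p q)}
      \<subseteq> span_iso C S"
    unfolding span_iso_def by blast
  then have "sim_zstar C S \<subseteq> span_iso C S"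
    unfolding sim_zstar_def by (rule generated_equiv_least[OF equiv_span_iso])
  then show "sim_a C S = span_iso C S" "sim_zstar C S = span_iso C S"
    using compatibleD(5)[OF compatible_sim_a] sim_a_subset_sim_zstar by blast+
qed


section \<open>The functor from Sect to Par\<close>

interpretation span: category "span_cat C S"
  by (rule category_span_cat)

lemmas sect_congruence = congruence_on_classes[OF compatible_sim_a equiv_sim_a]
lemmas par_congruence = congruence_on_classes[OF compatible_sim_zstar equiv_sim_zstar]

text \<open>The description defining \<open>Gamma\<close> has a unique value: representatives of one
  Sect class are related by \<open>sim_a\<close>, hence by \<open>sim_zstar\<close>, and so share
  their Par class.\<close>

lemma Gamma_class:
  assumes X: "X \<in> Arr (span_cat C S)"
  shows "Gamma C S (on_classes C S (sim_a C S) `` {X}) = on_classes C S (sim_zstar C S) `` {X}"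
proof -
  obtain p where p: "p \<in> spans C S" "X = span_class p"
    using X by (rule span_cat_arrE)
  have eq: "par_class C S q = par_class C S p"
    if q: "q \<in> spans C S" and c: "sect_class C S p = sect_class C S q" for q
  proof -
    note arr = span_class_arr[OF p(1)] span_class_arr[OF q]
    have "(p, q) \<in> sim_a C S"
      using c p(1) q on_classes_iff[OF compatible_sim_a equiv_sim_a]
        span.quotient_class_eq[OF sect_congruence arr]
      by (simp add: sect_class_def flip: span_class_def)
    then have "(p, q) \<in> sim_zstar C S"
      using sim_a_subset_sim_zstar by blast
    then show ?thesis
      using p(1) q on_classes_iff[OF compatible_sim_zstar equiv_sim_zstar]
        span.quotient_class_eq[OF par_congruence arr]
      by (simp add: par_class_def flip: span_class_def)
  qed
  have "Gamma C S (sect_class C S p) = par_class C S p"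
    unfolding Gamma_def by (rule the_equality) (use p(1) eq in blast)+
  then show ?thesis
    by (simp add: p(2) sect_class_def par_class_def flip: span_class_def)
qed

lemma functor_Gamma: "is_functor (sect_cat C S) (par_cat C S) (\<lambda>A. A) (Gamma C S)"
  unfolding sect_cat_def par_cat_def
  by (rule span.functor_quotient_mono[OF sect_congruence par_congruence Gamma_class])

lemma par_iso_sect_quotient:
  "isomorphic_categories (par_cat C S)
     (quotient_category (sect_cat C S) (induced_congruence (sect_cat C S) (Gamma C S)))"
proof (rule category.full_functor_iso_quotient[OF _ functor_Gamma])
  show "category (sect_cat C S)"
    unfolding sect_cat_def by (rule span.category_quotient[OF sect_congruence])
  show "Obj (sect_cat C S) = Obj (par_cat C S)"
    by (simp add: sect_cat_def par_cat_def quotient_category_def)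
  \<comment> \<open>Fullness: Sect and Par are quotients of the same \<open>span_cat\<close>, so a
    class in Par is the image of the Sect class of the same representative.\<close>
  show "Arr (par_cat C S) \<subseteq> Gamma C S ` Arr (sect_cat C S)"
  proof
    fix Y assume "Y \<in> Arr (par_cat C S)"
    then obtain X where X: "X \<in> Arr (span_cat C S)" "Y = on_classes C S (sim_zstar C S) `` {X}"
      unfolding par_cat_def by (rule span.quotient_arrE[OF par_congruence])
    show "Y \<in> Gamma C S ` Arr (sect_cat C S)"
      unfolding X(2) Gamma_class[OF X(1), symmetric] sect_cat_def
      by (intro imageI span.quotient_arr[OF sect_congruence X(1)])
  qed
qed

text \<open>Par and Sect become literally the same quotient, whereas Span is reached through the
  quotient by equality.\<close>

lemma mono_case_isos:
  assumes "\<forall>s \<in> S. is_mono C s"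
  shows "isomorphic_categories (par_cat C S) (sect_cat C S)"
    "isomorphic_categories (sect_cat C S) (span_cat C S)"
proof -
  note eq = sims_eq_span_iso_if_monos[OF assms]
  have "par_cat C S = sect_cat C S"
    by (simp add: par_cat_def sect_cat_def eq)
  then show "isomorphic_categories (par_cat C S) (sect_cat C S)"
    using isomorphic_categories_refl[OF span.category_quotient[OF sect_congruence]]
    by (simp add: sect_cat_def)
  show "isomorphic_categories (sect_cat C S) (span_cat C S)"
    using span.quotient_Id_iso by (simp add: sect_cat_def eq on_classes_span_iso)
qed

end

theorem corollary4:
  fixes C :: "('o, 'a) cat" and S :: "'a set"
  assumes "span_setting C S"
  shows "(is_functor (sect_cat C S) (par_cat C S) (\<lambda>A. A) (Gamma C S) \<and>
      isomorphic_categories (par_cat C S)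
        (quotient_category (sect_cat C S) (induced_congruence (sect_cat C S) (Gamma C S)))) \<and>
    ((\<forall>s \<in> S. is_mono C s) \<longrightarrow>
      isomorphic_categories (par_cat C S) (sect_cat C S) \<and>
      isomorphic_categories (sect_cat C S) (span_cat C S))"
proof -
  interpret span_setting C S by (rule assms)
  show ?thesis
    using functor_Gamma par_iso_sect_quotient mono_case_isos by blast
qed

end
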